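(* Let $\varepsilon=(\varepsilon_n)_{n\in\mathbf{Z}}$ be a coin-tossing sequence and, for each $n\in\mathbf{Z}$, let $H_n=h_n(\varepsilon_{n-1]})$ where $h_n:\{-1,1\}^{-\mathbf{N}}\to\{-1,1\}$ is measurable. Then for every $n\in\mathbf{Z}$ there exists a random variable $U_n$, measurable with respect to $\mathcal{F}_n^{\varepsilon}$, independent of $\mathcal{F}_\infty^{H\varepsilon}$, and uniform either on a finite set (of cardinality independent of $n$) or on $[0,1]$, such that $\mathcal{F}_n^{H\varepsilon}\vee\sigma(U_n)=\mathcal{F}_n^{\varepsilon}$ and $\mathcal{F}_\infty^{H\varepsilon}\vee\sigma(U_n)=\mathcal{F}_\infty^{\varepsilon}$.
   Context: $-\mathbf{N}=\{\dots,-2,-1,0\}$. A coin-tossing sequence is a family of independent random variables, each of law $(\delta_{-1}+\delta_1)/2$. For $x\in\{-1,1\}^{\mathbf{Z}}$ and $n\in\mathbf{Z}$, $x_{n]}=(x_{n+k})_{k\in-\mathbf{N}}$. For a process $\xi=(\xi_n)_{n\in\mathbf{Z}}$, $\mathcal{F}_n^{\xi}=\sigma((\xi_k)_{k\le n})$ and $\mathcal{F}_\infty^{\xi}=\sigma((\xi_k)_{k\in\mathbf{Z}})$; $H\varepsilon$ denotes the process $(H_n\varepsilon_n)_{n\in\mathbf{Z}}$. All $\sigma$-fields are completed (they contain all null events). *)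

theory Defs
  imports "HOL-Probability.Probability"
begin

abbreviation sign_space :: "int measure" where
  "sign_space \<equiv> count_space {-1, 1}"

text \<open>The law \<open>(\<delta>\<^sub>-\<^sub>1 + \<delta>\<^sub>1) / 2\<close> is the uniform measure on \<open>{-1, 1}\<close>; the variables
  take values in \<open>{-1, 1}\<close> everywhere on \<open>space M\<close>.\<close>

definition coin_tossing :: "'a measure \<Rightarrow> (int \<Rightarrow> 'a \<Rightarrow> int) \<Rightarrow> bool" where
  "coin_tossing M \<epsilon> \<longleftrightarrow>
     prob_space.indep_vars M (\<lambda>_. sign_space) \<epsilon> UNIV \<and>
     (\<forall>n. distr M sign_space (\<epsilon> n) = uniform_count_measure {-1, 1})"

text \<open>The index set \<open>-\<^bold>N\<close> is \<open>{..0}\<close>. The restriction makes the result an element of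
  \<open>space (PiM {..0} (\<lambda>_. sign_space))\<close>.\<close>

definition past_at :: "(int \<Rightarrow> 'b) \<Rightarrow> int \<Rightarrow> int \<Rightarrow> 'b" where
  "past_at x n = (\<lambda>k\<in>{..0}. x (n + k))"

text \<open>Sigma-fields are represented by measures of which only \<open>space\<close> and \<open>sets\<close> matter.
  Completion adjoins all null events of \<open>M\<close>; \<open>M\<close> itself need not be complete, and if it is,
  \<open>null_sets M\<close> consists of all negligible subsets of the sample space.\<close>

definition completed_sigma ::
  "'a measure \<Rightarrow> 'b measure \<Rightarrow> ('i \<Rightarrow> 'a \<Rightarrow> 'b) \<Rightarrow> 'i set \<Rightarrow> 'a measure" where
  "completed_sigma M N X I =
     sigma (space M) ({X i -` B \<inter> space M | i B. i \<in> I \<and> B \<in> sets N} \<union> null_sets M)"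

definition past_field :: "'a measure \<Rightarrow> (int \<Rightarrow> 'a \<Rightarrow> int) \<Rightarrow> int \<Rightarrow> 'a measure" where
  "past_field M \<xi> n = completed_sigma M sign_space \<xi> {..n}"

definition full_field :: "'a measure \<Rightarrow> (int \<Rightarrow> 'a \<Rightarrow> int) \<Rightarrow> 'a measure" where
  "full_field M \<xi> = completed_sigma M sign_space \<xi> UNIV"

definition var_field :: "'a measure \<Rightarrow> ('a \<Rightarrow> real) \<Rightarrow> 'a measure" where
  "var_field M U = completed_sigma M borel (\<lambda>_::unit. U) UNIV"

definition join_field :: "'a measure \<Rightarrow> 'a measure \<Rightarrow> 'a measure" where
  "join_field F G = sigma (space F) (sets F \<union> sets G)"

definition uniform_on_finite :: "'a measure \<Rightarrow> ('a \<Rightarrow> real) \<Rightarrow> real set \<Rightarrow> bool" where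
  "uniform_on_finite M U S \<longleftrightarrow> finite S \<and> S \<noteq> {} \<and>
     distr M borel U = distr (uniform_count_measure S) borel (\<lambda>x. x)"

definition uniform_on_unit_interval :: "'a measure \<Rightarrow> ('a \<Rightarrow> real) \<Rightarrow> bool" where
  "uniform_on_unit_interval M U \<longleftrightarrow> distr M borel U = uniform_measure lborel {0..1}"

end

theory Submission
  imports Defs
begin

text \<open>
  Write \<open>\<eta> n = H n * \<epsilon> n\<close>. Since \<open>H n\<close> is a sign that depends on the past of \<open>\<epsilon>\<close> only, \<open>\<eta> n\<close>
  is a fair coin independent of \<open>\<epsilon>\<close> up to time \<open>n - 1\<close>, and \<open>\<epsilon> n = H n * \<eta> n\<close>. So, once
  \<open>\<eta>\<close> is given, the past of \<open>\<epsilon>\<close> up to time \<open>n\<close> determines, and is determined by, its past up to any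
  other time. The complement at time \<open>n\<close> is the conditional distribution function of
  the past \<open>(\<epsilon> n, \<epsilon> (n - 1), \<dots>)\<close> given \<open>\<eta>\<close> up to time \<open>n\<close>, taken in lexicographic order and
  evaluated at the past that actually occurs (\<open>rank_var\<close>). Everything rests on one number:
  the conditional probability of the atom formed by that past (\<open>atom_mass\<close>).

  The atom mass does not depend on \<open>n\<close>, because pasts at different times are in bijection given
  \<open>\<eta>\<close> (\<open>atom_mass_step\<close>). So it is measurable with respect to the remote past of \<open>\<epsilon>\<close>, and
  Kolmogorov's zero-one law makes it a constant \<open>p\<close> (\<open>atom_mass_constant\<close>). Heuristically, all
  atoms of the conditional law then have mass \<open>p\<close>, so the law is either diffuse (\<open>p = 0\<close>) or
  uniform on \<open>1 / p\<close> points, and its distribution function at the random point is uniform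
  on \<open>[0, 1]\<close> or on \<open>{0, 1 / m, \<dots>, (m - 1) / m}\<close> with \<open>m = 1 / p\<close>.

  The rank is obtained as a limit of finite approximations. Cut the space according to the first \<open>k\<close>
  bits of the past; a cell \<open>w\<close> of conditional probability \<open>q w\<close> occupies the interval
  \<open>[low w, low w + q w]\<close>, and these intervals tile \<open>[0, 1]\<close>. Summing the Fourier
  integrals over the tiles telescopes, which gives, for each event \<open>A\<close> of the conditioning field,
  an identity between the characteristic function of the left endpoint and that of the uniform law
  on \<open>[0, 1]\<close> (\<open>char_rank_at\<close>). As \<open>k\<close> tends to infinity the tile length becomes \<open>p\<close>,
  and the characteristic function \<open>\<phi>\<close> of the rank given \<open>A\<close> satisfies \<open>K (\<theta> * p) * \<phi> \<theta> = K \<theta>\<close>,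
  where \<open>K\<close> is the characteristic function of the uniform law on \<open>[0, 1]\<close>.
  This equation has at most one solution. So the rank is independent of the conditioning field
  (\<open>rank_indep\<close>); it is uniform on \<open>[0, 1]\<close> if \<open>p = 0\<close>, and if \<open>p > 0\<close> the zero of \<open>K\<close> at \<open>2 * pi\<close>
  forces \<open>1 / p\<close> to be an integer (\<open>rank_uniform_grid\<close>).

  Conversely the rank lies in the half-open tile of the cell that occurs, so rank and
  conditioning field give back all bits of the past (\<open>AE_word_iff_rank\<close>); later values of \<open>\<epsilon>\<close>
  follow from \<open>\<epsilon> n = H n * \<eta> n\<close>.
\<close>

section \<open>Completed fields\<close>

text \<open>
  Completion is handled once and for all here: events of a completed field are represented, up to a
  null set, by events of the field generated before null events were added, so that all conditional
  probabilities below can be taken with respect to uncompleted fields.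
\<close>
lemma sigma_sets_adjoin_null:
  assumes \<G>: "\<G> \<subseteq> sets M"
    and A: "A \<in> sigma_sets (space M) (\<G> \<union> null_sets M)"
  shows "\<exists>B\<in>sigma_sets (space M) \<G>. (A - B) \<union> (B - A) \<in> null_sets M"
  using A
proof induction
  case (Basic a)
  then show ?case
  proof
    assume "a \<in> \<G>" then show ?thesis by (intro bexI[of _ a]) auto
  next
    assume "a \<in> null_sets M" then show ?thesis
      by (intro bexI[of _ "{}"]) (auto intro: sigma_sets.Empty)
  qed
next
  case Empty
  then show ?case by (intro bexI[of _ "{}"]) (auto intro: sigma_sets.Empty)
next
  case (Compl a)
  then obtain B where B: "B \<in> sigma_sets (space M) \<G>" "(a - B) \<union> (B - a) \<in> null_sets M" by auto
  have "sigma_sets (space M) (\<G> \<union> null_sets M) \<subseteq> sets M"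
    using \<G> by (intro sets.sigma_sets_subset) auto
  then have "a \<subseteq> space M" using Compl.hyps sets.sets_into_space by blast
  moreover have "B \<subseteq> space M"
    using B(1) sets.sigma_sets_subset[OF \<G>] sets.sets_into_space by blast
  ultimately have "(space M - a - (space M - B)) \<union> (space M - B - (space M - a)) = (a - B) \<union> (B - a)"
    by auto
  with B show ?case by (intro bexI[of _ "space M - B"]) (auto intro: sigma_sets.Compl)
next
  case (Union a)
  then obtain B where B: "\<And>i. B i \<in> sigma_sets (space M) \<G>"
      "\<And>i::nat. (a i - B i) \<union> (B i - a i) \<in> null_sets M"
    by metis
  have N: "(\<Union>i. (a i - B i) \<union> (B i - a i)) \<in> null_sets M"
    using B(2) by (intro null_sets_UN) auto
  have m: "a i \<in> sets M" for i
  proof -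
    have "sigma_sets (space M) (\<G> \<union> null_sets M) \<subseteq> sets M"
      using \<G> by (intro sets.sigma_sets_subset) auto
    then show ?thesis using Union.hyps by blast
  qed
  have m': "B i \<in> sets M" for i
    using B(1) sets.sigma_sets_subset[OF \<G>] by blast
  have "(\<Union>(range a) - \<Union>(range B)) \<union> (\<Union>(range B) - \<Union>(range a)) \<in> null_sets M"
    using m m' by (intro null_sets_subset[OF N]) auto
  with B show ?case by (intro bexI[of _ "\<Union>(range B)"]) (auto intro: sigma_sets.Union)
qed

lemma (in prob_space) indep_set_adjoin_null:
  assumes ind: "indep_set (sigma_sets (space M) \<A>) (sigma_sets (space M) \<B>)"
  shows "indep_set (sigma_sets (space M) (\<A> \<union> null_sets M)) (sigma_sets (space M) (\<B> \<union> null_sets M))"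
proof (rule indep_setI)
  have ev: "sigma_sets (space M) \<A> \<subseteq> events" "sigma_sets (space M) \<B> \<subseteq> events"
    using indep_setD_ev1[OF ind] indep_setD_ev2[OF ind] .
  then have AB: "\<A> \<subseteq> events" "\<B> \<subseteq> events" by (auto intro: sigma_sets.Basic)
  then show sub: "sigma_sets (space M) (\<A> \<union> null_sets M) \<subseteq> events"
    "sigma_sets (space M) (\<B> \<union> null_sets M) \<subseteq> events"
    by (intro sets.sigma_sets_subset; auto)+
  fix a b
  assume a: "a \<in> sigma_sets (space M) (\<A> \<union> null_sets M)" and b: "b \<in> sigma_sets (space M) (\<B> \<union> null_sets M)"
  obtain a' where a': "a' \<in> sigma_sets (space M) \<A>" "(a - a') \<union> (a' - a) \<in> null_sets M"
    using sigma_sets_adjoin_null[OF AB(1) a] by blast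
  obtain b' where b': "b' \<in> sigma_sets (space M) \<B>" "(b - b') \<union> (b' - b) \<in> null_sets M"
    using sigma_sets_adjoin_null[OF AB(2) b] by blast
  have [measurable]: "a \<in> events" "b \<in> events" "a' \<in> events" "b' \<in> events"
    using a b a' b' sub ev by auto
  have "AE \<omega> in M. \<omega> \<in> a \<longleftrightarrow> \<omega> \<in> a'" "AE \<omega> in M. \<omega> \<in> b \<longleftrightarrow> \<omega> \<in> b'"
    using AE_not_in[OF a'(2)] AE_not_in[OF b'(2)] by (auto elim: eventually_mono)
  then have "prob (a \<inter> b) = prob (a' \<inter> b')" "prob a = prob a'" "prob b = prob b'"
    by (auto intro!: finite_measure_eq_AE)
  then show "prob (a \<inter> b) = prob a * prob b"
    using indep_setD[OF ind a'(1) b'(1)] by simp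
qed

lemma sets_completed_sigma:
  assumes "\<And>i. i \<in> I \<Longrightarrow> X i \<in> measurable M N"
  shows "space (completed_sigma M N X I) = space M"
    and "sets (completed_sigma M N X I) =
      sigma_sets (space M) ({X i -` B \<inter> space M | i B. i \<in> I \<and> B \<in> sets N} \<union> null_sets M)"
proof -
  have "{X i -` B \<inter> space M | i B. i \<in> I \<and> B \<in> sets N} \<union> null_sets M \<subseteq> Pow (space M)"
    using sets.sets_into_space by blast
  then show "space (completed_sigma M N X I) = space M"
    "sets (completed_sigma M N X I) =
      sigma_sets (space M) ({X i -` B \<inter> space M | i B. i \<in> I \<and> B \<in> sets N} \<union> null_sets M)"
    unfolding completed_sigma_def by (simp_all add: space_measure_of_conv)
qed

lemma completed_sigma_subset:
  assumes "\<And>i. i \<in> I \<Longrightarrow> X i \<in> measurable M N"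
    and "space J = space M" "null_sets M \<subseteq> sets J" "\<And>i. i \<in> I \<Longrightarrow> X i \<in> measurable J N"
  shows "sets (completed_sigma M N X I) \<subseteq> sets J"
proof -
  have "X i -` B \<inter> space M \<in> sets J" if "i \<in> I" "B \<in> sets N" for i B
    using measurable_sets[OF assms(4)[OF that(1)] that(2)] assms(2) by simp
  then have "{X i -` B \<inter> space M | i B. i \<in> I \<and> B \<in> sets N} \<union> null_sets M \<subseteq> sets J"
    using assms(3) by blast
  from sets.sigma_sets_subset[OF this] show ?thesis
    using assms(1,2) by (simp add: sets_completed_sigma(2))
qed

lemma measurable_completed_sigma:
  assumes X: "\<And>i. i \<in> I \<Longrightarrow> X i \<in> measurable M N" and "i \<in> I"
  shows "X i \<in> measurable (completed_sigma M N X I) N"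
proof (rule measurableI)
  show "\<omega> \<in> space (completed_sigma M N X I) \<Longrightarrow> X i \<omega> \<in> space N" for \<omega>
    using measurable_space[OF X[OF \<open>i \<in> I\<close>]] by (simp add: sets_completed_sigma(1)[OF X])
  show "X i -` B \<inter> space (completed_sigma M N X I) \<in> sets (completed_sigma M N X I)" if "B \<in> sets N" for B
  proof -
    have "X i -` B \<inter> space M \<in> sigma_sets (space M) ({X i -` B \<inter> space M | i B. i \<in> I \<and> B \<in> sets N} \<union> null_sets M)"
      using that \<open>i \<in> I\<close> by (intro sigma_sets.Basic) blast
    then show ?thesis using X by (simp add: sets_completed_sigma)
  qed
qed

lemma null_sets_completed_sigma:
  assumes X: "\<And>i. i \<in> I \<Longrightarrow> X i \<in> measurable M N"
  shows "null_sets M \<subseteq> sets (completed_sigma M N X I)"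
  using X by (auto simp: sets_completed_sigma(2) intro: sigma_sets.Basic)

lemma join_field:
  assumes "space F = space G"
  shows "space (join_field F G) = space F" "sets F \<subseteq> sets (join_field F G)" "sets G \<subseteq> sets (join_field F G)"
    and "\<lbrakk>space J = space F; sets F \<subseteq> sets J; sets G \<subseteq> sets J\<rbrakk> \<Longrightarrow> sets (join_field F G) \<subseteq> sets J"
proof -
  have P: "sets F \<union> sets G \<subseteq> Pow (space F)"
    using assms sets.sets_into_space by blast
  then have S: "sets (join_field F G) = sigma_sets (space F) (sets F \<union> sets G)"
    by (simp add: join_field_def)
  show "space (join_field F G) = space F" by (simp add: join_field_def space_measure_of_conv)
  show "sets F \<subseteq> sets (join_field F G)" "sets G \<subseteq> sets (join_field F G)"
    unfolding S by (auto intro: sigma_sets.Basic)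
  assume "space J = space F" "sets F \<subseteq> sets J" "sets G \<subseteq> sets J"
  then show "sets (join_field F G) \<subseteq> sets J"
    unfolding S by (metis Un_least sets.sigma_sets_subset)
qed

lemma past_field:
  assumes X: "\<And>k. X k \<in> measurable M sign_space"
  shows space_past_field: "space (past_field M X n) = space M"
    and null_sets_past_field: "null_sets M \<subseteq> sets (past_field M X n)"
    and measurable_past_field: "k \<le> n \<Longrightarrow> X k \<in> measurable (past_field M X n) sign_space"
    and past_field_subset: "\<lbrakk>space J = space M; null_sets M \<subseteq> sets J;
      \<And>k. k \<le> n \<Longrightarrow> X k \<in> measurable J sign_space\<rbrakk> \<Longrightarrow> sets (past_field M X n) \<subseteq> sets J"
  unfolding past_field_def using X
  by (simp_all add: sets_completed_sigma(1) null_sets_completed_sigma measurable_completed_sigma)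
    (rule completed_sigma_subset, auto)

lemma full_field:
  assumes X: "\<And>k. X k \<in> measurable M sign_space"
  shows space_full_field: "space (full_field M X) = space M"
    and null_sets_full_field: "null_sets M \<subseteq> sets (full_field M X)"
    and measurable_full_field: "X k \<in> measurable (full_field M X) sign_space"
    and full_field_subset: "\<lbrakk>space J = space M; null_sets M \<subseteq> sets J;
      \<And>k. X k \<in> measurable J sign_space\<rbrakk> \<Longrightarrow> sets (full_field M X) \<subseteq> sets J"
  unfolding full_field_def using X
  by (simp_all add: sets_completed_sigma(1) null_sets_completed_sigma measurable_completed_sigma completed_sigma_subset)

lemma subalgebra_full_past_field:
  assumes X: "\<And>k. X k \<in> measurable M sign_space"
  shows "subalgebra (full_field M X) (past_field M X n)"
  using past_field_subset[of X M "full_field M X" n, OF X space_full_field[of X, OF X]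
      null_sets_full_field[of X, OF X] measurable_full_field[of X, OF X]]
  by (simp add: subalgebra_def space_past_field[of X, OF X] space_full_field[of X, OF X])

lemma var_field:
  assumes U: "U \<in> borel_measurable M"
  shows space_var_field: "space (var_field M U) = space M"
    and measurable_var_field: "U \<in> borel_measurable (var_field M U)"
    and var_field_subset: "\<lbrakk>space J = space M; null_sets M \<subseteq> sets J; U \<in> borel_measurable J\<rbrakk>
      \<Longrightarrow> sets (var_field M U) \<subseteq> sets J"
proof -
  show "space (var_field M U) = space M"
    unfolding var_field_def by (intro sets_completed_sigma U)
  show "U \<in> borel_measurable (var_field M U)"
    unfolding var_field_def by (intro measurable_completed_sigma[where X = "\<lambda>_::unit. U" and i = "()"] U) simp
  show "sets (var_field M U) \<subseteq> sets J"
    if "space J = space M" "null_sets M \<subseteq> sets J" "U \<in> borel_measurable J"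
    unfolding var_field_def by (intro completed_sigma_subset U that)
qed

section \<open>Conditional probabilities\<close>

lemma Int_stable_vimages: "Int_stable {f -` S \<inter> \<Omega> | S. S \<in> sets N}"
  unfolding Int_stable_def
proof safe
  fix S T assume "S \<in> sets N" "T \<in> sets N"
  then show "\<exists>R. f -` S \<inter> \<Omega> \<inter> (f -` T \<inter> \<Omega>) = f -` R \<inter> \<Omega> \<and> R \<in> sets N"
    by (intro exI[of _ "S \<inter> T"]) auto
qed

lemma Int_stable_pairs:
  assumes "Int_stable \<A>" "Int_stable \<B>"
  shows "Int_stable {C \<inter> D | C D. C \<in> \<A> \<and> D \<in> \<B>}"
  unfolding Int_stable_def
proof (intro ballI)
  fix a c assume "a \<in> {C \<inter> D | C D. C \<in> \<A> \<and> D \<in> \<B>}" "c \<in> {C \<inter> D | C D. C \<in> \<A> \<and> D \<in> \<B>}"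
  then obtain C D C' D' where *: "a = C \<inter> D" "c = C' \<inter> D'" "C \<in> \<A>" "C' \<in> \<A>" "D \<in> \<B>" "D' \<in> \<B>" by blast
  then have "a \<inter> c = (C \<inter> C') \<inter> (D \<inter> D')" by auto
  moreover have "C \<inter> C' \<in> \<A>" "D \<inter> D' \<in> \<B>" using * assms by (auto simp: Int_stable_def)
  ultimately show "a \<inter> c \<in> {C \<inter> D | C D. C \<in> \<A> \<and> D \<in> \<B>}" by blast
qed

locale conditioning = prob_space M for M :: "'a measure" +
  fixes F :: "'a measure"
  assumes subalg: "subalgebra M F"

sublocale conditioning \<subseteq> finite_measure_subalgebra M F
  by unfold_locales (rule subalg)

context conditioning
begin

definition cprob :: "'a set \<Rightarrow> 'a \<Rightarrow> real" where
  "cprob A = real_cond_exp M F (indicator A)"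

lemma cprob_measurable [measurable]: "cprob A \<in> borel_measurable F" "cprob A \<in> borel_measurable M"
  by (simp_all add: cprob_def)

lemma F_events: "A \<in> sets F \<Longrightarrow> A \<in> events"
  using subalg by (auto simp: subalgebra_def)

lemma cprob_nonneg: "A \<in> events \<Longrightarrow> AE \<omega> in M. 0 \<le> cprob A \<omega>"
  unfolding cprob_def by (intro real_cond_exp_pos) auto

lemma integrable_ind: "A \<in> events \<Longrightarrow> integrable M (indicator A :: 'a \<Rightarrow> real)"
  by (simp add: less_top[symmetric])

lemma cprob_le_1: "A \<in> events \<Longrightarrow> AE \<omega> in M. cprob A \<omega> \<le> 1"
  unfolding cprob_def by (intro real_cond_exp_le_c integrable_ind) auto

lemma cprob_union:
  assumes [measurable]: "A \<in> events" "B \<in> events" and "A \<inter> B = {}"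
  shows "AE \<omega> in M. cprob (A \<union> B) \<omega> = cprob A \<omega> + cprob B \<omega>"
proof -
  have "indicator (A \<union> B) = (\<lambda>\<omega>. indicator A \<omega> + indicator B \<omega> :: real)"
    using assms by (auto simp: indicator_def fun_eq_iff)
  then show ?thesis
    unfolding cprob_def using real_cond_exp_add[OF integrable_ind integrable_ind, of A B] by simp
qed

lemma cprob_mono:
  assumes "A \<in> events" "B \<in> events" "A \<subseteq> B"
  shows "AE \<omega> in M. cprob A \<omega> \<le> cprob B \<omega>"
  unfolding cprob_def using assms
  by (intro real_cond_exp_mono integrable_ind) (auto split: split_indicator)

lemma cprob_F:
  assumes "A \<in> sets F"
  shows "AE \<omega> in M. cprob A \<omega> = indicator A \<omega>"
  unfolding cprob_def using assms F_events by (intro real_cond_exp_F_meas integrable_ind) auto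

lemma cprob_bounds:
  assumes "A \<in> events"
  shows "AE \<omega> in M. norm (cprob A \<omega>) \<le> 1"
  using cprob_nonneg[OF assms] cprob_le_1[OF assms] by eventually_elim auto

lemma integral_cprob_mult:
  fixes f :: "'a \<Rightarrow> real"
  assumes A[measurable]: "A \<in> events" and f: "f \<in> borel_measurable F"
    and bound: "AE \<omega> in M. \<bar>f \<omega>\<bar> \<le> C"
  shows "(\<integral>\<omega>. f \<omega> * indicator A \<omega> \<partial>M) = (\<integral>\<omega>. f \<omega> * cprob A \<omega> \<partial>M)"
proof -
  have [measurable]: "f \<in> borel_measurable M" using f measurable_from_subalg[OF subalg] by blast
  have "integrable M (\<lambda>\<omega>. f \<omega> * indicator A \<omega>)"
    by (rule integrable_const_bound[of _ "max 0 C"]) (use bound in \<open>auto split: split_indicator elim: eventually_mono\<close>)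
  from real_cond_exp_intg(2)[OF this f] show ?thesis
    unfolding cprob_def by simp
qed

lemma integral_cprob_mult_complex:
  fixes f :: "'a \<Rightarrow> complex"
  assumes A[measurable]: "A \<in> events" and f: "f \<in> borel_measurable F"
    and bound: "\<And>\<omega>. norm (f \<omega>) \<le> C"
  shows "(\<integral>\<omega>. f \<omega> * indicator A \<omega> \<partial>M) = (\<integral>\<omega>. f \<omega> * cprob A \<omega> \<partial>M)"
proof -
  have [measurable]: "f \<in> borel_measurable M" using f measurable_from_subalg[OF subalg] by blast
  have i1: "integrable M (\<lambda>\<omega>. f \<omega> * indicator A \<omega>)"
    using order_trans[OF norm_ge_zero bound]
    by (intro integrable_const_bound[of _ C] AE_I2) (auto split: split_indicator simp: bound)
  have b: "AE \<omega> in M. norm (f \<omega> * cprob A \<omega>) \<le> C"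
    using cprob_bounds[OF A]
  proof eventually_elim
    case (elim \<omega>)
    then show ?case using mult_mono[OF bound[of \<omega>] elim] order_trans[OF norm_ge_zero bound]
      by (simp add: norm_mult)
  qed
  have i2: "integrable M (\<lambda>\<omega>. f \<omega> * cprob A \<omega>)"
    by (rule integrable_const_bound[OF b]) simp
  have c: "of_real (indicator A \<omega>) = (indicator A \<omega> :: complex)" for \<omega>
    by (simp split: split_indicator)
  have bR: "\<bar>Re (f \<omega>)\<bar> \<le> C" "\<bar>Im (f \<omega>)\<bar> \<le> C" for \<omega>
    using order_trans[OF abs_Re_le_cmod bound] order_trans[OF abs_Im_le_cmod bound] by auto
  have "(\<integral>\<omega>. Re (f \<omega>) * indicator A \<omega> \<partial>M) = (\<integral>\<omega>. Re (f \<omega>) * cprob A \<omega> \<partial>M)"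
    "(\<integral>\<omega>. Im (f \<omega>) * indicator A \<omega> \<partial>M) = (\<integral>\<omega>. Im (f \<omega>) * cprob A \<omega> \<partial>M)"
    using f bR by (auto intro!: integral_cprob_mult[OF A] AE_I2)
  then show ?thesis
    unfolding complex_eq_iff integral_Re[OF i1, symmetric] integral_Im[OF i1, symmetric]
      integral_Re[OF i2, symmetric] integral_Im[OF i2, symmetric]
    by (simp add: c[symmetric])
qed

end

text \<open>
  Independent extra information does not change conditional probabilities: \<open>\<K>\<close> generates the new
  information, and it is independent of a field \<open>G\<close> that contains both \<open>A\<close> and the old
  information. On \<open>C \<inter> D\<close> the factor coming from \<open>D\<close> splits off on both sides of the defining
  identity, and such sets form a \<open>\<pi>\<close>-system that generates \<open>F'\<close>.
\<close>
lemma (in conditioning) cprob_adjoin_independent: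
  assumes F': "conditioning M F'"
    and gen: "sets F' = sigma_sets (space M) {C \<inter> D | C D. C \<in> sets F \<and> D \<in> \<K>}"
    and FF': "subalgebra F' F"
    and \<K>: "\<K> \<subseteq> events" "Int_stable \<K>"
    and G: "subalgebra M G" "subalgebra G F"
    and indep: "\<And>B D. B \<in> sets G \<Longrightarrow> D \<in> \<K> \<Longrightarrow> prob (B \<inter> D) = prob B * prob D"
    and A: "A \<in> sets G"
  shows "AE \<omega> in M. conditioning.cprob M F' A \<omega> = cprob A \<omega>"
proof -
  interpret F': conditioning M F' by (rule F')
  let ?gen = "{C \<inter> D | C D. C \<in> sets F \<and> D \<in> \<K>}"
  have A'[measurable]: "A \<in> events" using A G by (auto simp: subalgebra_def)
  have GF: "sets F \<subseteq> sets G" using G by (auto simp: subalgebra_def)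
  have int: "integrable M (\<lambda>\<omega>. cprob A \<omega>)" unfolding cprob_def by (intro real_cond_exp_int integrable_ind A')
  have on_pairs: "(\<integral>\<omega>. indicator (C \<inter> D) \<omega> * indicator A \<omega> \<partial>M) = (\<integral>\<omega>. indicator (C \<inter> D) \<omega> * cprob A \<omega> \<partial>M)"
    if C: "C \<in> sets F" and D: "D \<in> \<K>" for C D
  proof -
    have [measurable]: "C \<in> events" "D \<in> events" using C D \<K> F_events by auto
    have iv: "indep_var borel (\<lambda>\<omega>. indicator C \<omega> * cprob A \<omega>) borel (indicator D :: 'a \<Rightarrow> real)"
      unfolding indep_var_eq
    proof (intro conjI indep_set_sigma_sets indep_setI)
      have f: "(\<lambda>\<omega>. indicator C \<omega> * cprob A \<omega>) \<in> borel_measurable F" using C by measurable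
      show "prob (a \<inter> c) = prob a * prob c"
        if "a \<in> {(\<lambda>\<omega>. indicator C \<omega> * cprob A \<omega>) -` S \<inter> space M |S. S \<in> sets borel}"
          "c \<in> {indicator D -` S \<inter> space M |S. S \<in> sets (borel :: real measure)}" for a c
      proof -
        have a: "a \<in> sets F" using that(1) measurable_sets[OF f] subalg by (auto simp: subalgebra_def)
        then have aM[measurable]: "a \<in> events" by (rule F_events)
        from that(2) obtain S where c: "c = (indicator D :: 'a \<Rightarrow> real) -` S \<inter> space M" by auto
        have ss: "D \<subseteq> space M" "a \<subseteq> space M" using sets.sets_into_space[of D M] sets.sets_into_space[of a M] by auto
        have a_D: "a \<inter> (space M - D) = a - D" using ss by auto
        have pD: "prob (a \<inter> D) = prob a * prob D" using a D GF indep by blast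
        have "prob (space M - D) = 1 - prob D" by (rule prob_compl) simp
        then have "prob a * prob (space M - D) = prob a - prob a * prob D" by (simp add: right_diff_distrib)
        moreover have "prob (a - D) = prob a - prob (a \<inter> D)" by (rule finite_measure_Diff') auto
        ultimately have pD': "prob (a \<inter> (space M - D)) = prob a * prob (space M - D)"
          using pD by (simp add: a_D)
        have "c = (if 1 \<in> S then D else {}) \<union> (if 0 \<in> S then space M - D else {})"
        proof (intro set_eqI)
          fix \<omega>
          show "\<omega> \<in> c \<longleftrightarrow> \<omega> \<in> (if 1 \<in> S then D else {}) \<union> (if 0 \<in> S then space M - D else {})"
            using ss(1) by (cases "\<omega> \<in> D") (auto simp: c)
        qed
        moreover have "D \<union> (space M - D) = space M" using ss(1) by auto
        ultimately have "c = {} \<or> c = D \<or> c = space M - D \<or> c = space M" by (auto split: if_splits)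
        then show ?thesis using pD pD' ss by (auto simp: Int_absorb2 prob_space)
      qed
    qed (auto simp: measurable_sets intro: Int_stable_vimages)
    have "(\<integral>\<omega>. indicator (C \<inter> D) \<omega> * cprob A \<omega> \<partial>M) = (\<integral>\<omega>. (indicator C \<omega> * cprob A \<omega>) * indicator D \<omega> \<partial>M)"
      by (intro Bochner_Integration.integral_cong) (auto split: split_indicator)
    also have "\<dots> = (\<integral>\<omega>. indicator C \<omega> * cprob A \<omega> \<partial>M) * (\<integral>\<omega>. indicator D \<omega> \<partial>M)"
      by (rule indep_var_lebesgue_integral[OF iv])
        (auto intro!: integrable_ind integrable_real_mult_indicator int simp: mult.commute[of "indicator C _"])
    also have "(\<integral>\<omega>. indicator C \<omega> * cprob A \<omega> \<partial>M) = (\<integral>\<omega>. indicator C \<omega> * indicator A \<omega> \<partial>M)"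
      using C by (intro integral_cprob_mult[symmetric, where C = 1] A') (auto split: split_indicator)
    also have "\<dots> = prob (C \<inter> A)" by (simp flip: indicator_inter_arith)
    also have "prob (C \<inter> A) * (\<integral>\<omega>. indicator D \<omega> \<partial>M) = prob (C \<inter> A \<inter> D)"
      using C A GF D by (subst indep) auto
    also have "\<dots> = (\<integral>\<omega>. indicator (C \<inter> D) \<omega> * indicator A \<omega> \<partial>M)"
      by (simp flip: indicator_inter_arith) (simp add: Int_ac)
    finally show ?thesis by simp
  qed
  have "(\<integral>\<omega>. indicator E \<omega> * indicator A \<omega> \<partial>M) = (\<integral>\<omega>. indicator E \<omega> * cprob A \<omega> \<partial>M)" if "E \<in> sets F'" for E
  proof -
    have P: "?gen \<subseteq> Pow (space M)" using F_events sets.sets_into_space by fastforce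
    have I: "Int_stable ?gen"
      using \<K>(2) by (intro Int_stable_pairs) (auto simp: Int_stable_def)
    from I P that[unfolded gen] show ?thesis
    proof (induction rule: sigma_sets_induct_disjoint)
      case (basic E)
      then show ?case using on_pairs by blast
    next
      case empty
      show ?case by simp
    next
      case (compl E)
      have E[measurable]: "E \<in> events" using compl(1) F'.F_events gen by auto
      have "(\<integral>\<omega>. indicator (space M - E) \<omega> * g \<omega> \<partial>M) = (\<integral>\<omega>. g \<omega> \<partial>M) - (\<integral>\<omega>. indicator E \<omega> * g \<omega> \<partial>M)"
        if g: "integrable M g" for g :: "'a \<Rightarrow> real"
      proof -
        have "integrable M (\<lambda>\<omega>. indicator E \<omega> * g \<omega>)"
          using integrable_real_mult_indicator[OF E g] by (simp add: mult.commute)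
        from Bochner_Integration.integral_diff[OF g this]
        have "(\<integral>\<omega>. g \<omega> - indicator E \<omega> * g \<omega> \<partial>M) = (\<integral>\<omega>. g \<omega> \<partial>M) - (\<integral>\<omega>. indicator E \<omega> * g \<omega> \<partial>M)" .
        moreover have "(\<integral>\<omega>. indicator (space M - E) \<omega> * g \<omega> \<partial>M) = (\<integral>\<omega>. g \<omega> - indicator E \<omega> * g \<omega> \<partial>M)"
          by (intro Bochner_Integration.integral_cong) (auto split: split_indicator)
        ultimately show ?thesis by simp
      qed
      moreover have "(\<integral>\<omega>. cprob A \<omega> \<partial>M) = (\<integral>\<omega>. indicator A \<omega> \<partial>M)"
        unfolding cprob_def by (intro real_cond_exp_int integrable_ind A')
      ultimately show ?case using compl(2) int integrable_ind[OF A'] by simp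
    next
      case (union E)
      have [measurable]: "E i \<in> events" for i using union(2) F'.F_events gen by auto
      have "(\<integral>\<omega>. indicator (\<Union>i. E i) \<omega> * g \<omega> \<partial>M) = (\<Sum>i. \<integral>\<omega>. indicator (E i) \<omega> * g \<omega> \<partial>M)"
        if g: "integrable M g" for g :: "'a \<Rightarrow> real"
      proof -
        have "set_integrable M (\<Union>i. E i) g"
          unfolding set_integrable_def using g by (intro integrable_mult_indicator) auto
        then have "(LINT \<omega>:(\<Union>i. E i)|M. g \<omega>) = (\<Sum>i. (LINT \<omega>:(E i)|M. g \<omega>))"
          using union(1) by (intro lebesgue_integral_countable_add) (auto simp: disjoint_family_on_def)
        then show ?thesis by (simp add: set_lebesgue_integral_def)
      qed
      then show ?case using union(3) int integrable_ind[OF A'] by simp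
    qed
  qed
  then show ?thesis
    unfolding F'.cprob_def using measurable_from_subalg[OF FF' cprob_measurable(1)] int
    by (intro F'.real_cond_exp_charact) (auto simp: set_lebesgue_integral_def intro!: integrable_ind)
qed

section \<open>A Fourier quotient that identifies the uniform laws\<close>

text \<open>
  The characteristic function of the uniform law on \<open>[0, 1]\<close>.
\<close>
definition mean_iexp :: "real \<Rightarrow> complex" where
  "mean_iexp x = (if x = 0 then 1 else (iexp x - 1) / (\<i> * x))"

lemma mean_iexp_0 [simp]: "mean_iexp 0 = 1"
  by (simp add: mean_iexp_def)

lemma mean_iexp_mult: "\<i> * x * mean_iexp x = iexp x - 1"
  by (simp add: mean_iexp_def)

lemma mean_iexp_zero_iff: "mean_iexp x = 0 \<longleftrightarrow> x \<noteq> 0 \<and> iexp x = 1"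
  by (simp add: mean_iexp_def)

lemma norm_mean_iexp_le: "norm (mean_iexp x) \<le> 1"
  using iexp_approx1[of x 0] by (auto simp: mean_iexp_def norm_divide norm_mult divide_le_eq)

lemma mean_iexp_near_0: "norm (mean_iexp x - 1) \<le> \<bar>x\<bar>"
proof (cases "x = 0")
  case False
  have "mean_iexp x - 1 = (iexp x - (1 + \<i> * x)) / (\<i> * x)"
    using False by (simp add: mean_iexp_def field_simps)
  moreover have "norm (iexp x - (1 + \<i> * x)) \<le> \<bar>x\<bar> ^ 2 / 2"
    using iexp_approx1[of x 1] by (simp add: eval_nat_numeral)
  ultimately have "norm (mean_iexp x - 1) \<le> \<bar>x\<bar> ^ 2 / 2 / \<bar>x\<bar>"
    using False by (simp only: norm_divide norm_mult) (simp add: divide_simps)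
  moreover have "a ^ 2 / 2 / a \<le> a" if "0 < a" for a :: real
    using that by (simp add: power2_eq_square)
  ultimately show ?thesis using False by (metis order_trans zero_less_abs_iff)
qed simp

lemma isCont_mean_iexp: "isCont mean_iexp x"
proof (cases "x = 0")
  case True
  have "(\<lambda>h. mean_iexp h - 1) \<midarrow>0\<rightarrow> 0"
    by (rule Lim_null_comparison[where g = "\<lambda>h. \<bar>h\<bar>"])
      (auto simp: mean_iexp_near_0 intro!: tendsto_eq_intros)
  then have "mean_iexp \<midarrow>0\<rightarrow> 1" by (simp add: LIM_zero_iff)
  with True show ?thesis by (simp add: isCont_def)
next
  case False
  have "\<forall>\<^sub>F h in nhds x. mean_iexp h = (iexp h - 1) / (\<i> * h)"
    using t1_space_nhds[OF False] by eventually_elim (simp add: mean_iexp_def)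
  moreover have "isCont (\<lambda>h. (iexp h - 1) / (\<i> * h)) x"
    using False by (intro continuous_intros) auto
  ultimately show ?thesis by (simp add: isCont_cong)
qed

lemma mean_iexp_measurable [measurable]: "mean_iexp \<in> borel_measurable borel"
  by (intro borel_measurable_continuous_onI continuous_at_imp_continuous_on ballI isCont_mean_iexp)

text \<open>
  Adding to a random variable an independent one, uniform on \<open>[0, p]\<close>, multiplies its characteristic
  function by \<open>mean_iexp (\<theta> * p)\<close>; a law for which this yields the uniform law on \<open>[0, 1]\<close> is
  determined by \<open>p\<close>. Where the factor does not vanish one can divide; its zeros are isolated, so
  continuity of characteristic functions settles the remaining points.
\<close>
lemma char_quotient_unique:
  assumes \<mu>: "real_distribution \<mu>" and \<nu>: "real_distribution \<nu>"
    and eq: "\<And>\<theta>. mean_iexp (\<theta> * p) * char \<mu> \<theta> = mean_iexp \<theta>"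
      "\<And>\<theta>. mean_iexp (\<theta> * p) * char \<nu> \<theta> = mean_iexp \<theta>"
  shows "\<mu> = \<nu>"
proof (rule Levy_uniqueness[OF \<mu> \<nu>], rule ext)
  fix \<theta>
  have off_zero: "char \<mu> t = char \<nu> t" if "mean_iexp (t * p) \<noteq> 0" for t
    using eq[of t] that by (metis mult_left_cancel)
  show "char \<mu> \<theta> = char \<nu> \<theta>"
  proof (cases "mean_iexp (\<theta> * p) = 0")
    case True
    then have p: "p \<noteq> 0" and 1: "iexp (\<theta> * p) = 1" by (auto simp: mean_iexp_zero_iff)
    \<comment> \<open>The zeros of \<open>mean_iexp\<close> are the nonzero multiples of \<open>2 * pi\<close>, so moving its argument by
      \<open>1 / (n + 1)\<close> leaves them.\<close>
    define t where "t n = \<theta> + (1 / p) * inverse (real (Suc n))" for n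
    have t: "t \<longlonglongrightarrow> \<theta>"
      unfolding t_def
      using tendsto_add[OF tendsto_const[of \<theta>] tendsto_mult_right[OF LIMSEQ_inverse_real_of_nat, of "1 / p"]]
      by simp
    have "mean_iexp (t n * p) \<noteq> 0" for n
    proof -
      have "iexp (t n * p) = iexp (\<theta> * p) * iexp (inverse (real (Suc n)))"
        using p by (simp add: t_def ring_distribs exp_add del: of_nat_Suc)
      moreover have "Im (iexp (inverse (real (Suc n)))) \<noteq> 0"
      proof -
        have "inverse (real (Suc n)) \<le> 1" by (simp add: field_simps)
        then have "0 < sin (inverse (real (Suc n)))"
          using pi_gt3 by (intro sin_gt_zero) (auto simp del: of_nat_Suc)
        moreover have "Im (iexp t) \<noteq> 0" if "0 < sin t" for t
          using that by (simp add: Im_exp)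
        ultimately show ?thesis by blast
      qed
      ultimately show ?thesis using 1 by (metis mean_iexp_zero_iff mult_1 one_complex.sel(2))
    qed
    then have "(\<lambda>n. char \<mu> (t n)) = (\<lambda>n. char \<nu> (t n))" using off_zero by auto
    moreover have "(\<lambda>n. char \<mu> (t n)) \<longlonglongrightarrow> char \<mu> \<theta>"
      "(\<lambda>n. char \<nu> (t n)) \<longlonglongrightarrow> char \<nu> \<theta>"
      using real_distribution.isCont_char[OF \<mu>] real_distribution.isCont_char[OF \<nu>] t
      by (auto intro: isCont_tendsto_compose)
    ultimately show ?thesis by (metis LIMSEQ_unique)
  qed (rule off_zero)
qed

lemma char_uniform_unit_interval: "char (uniform_measure lborel {0..1}) \<theta> = mean_iexp \<theta>"
proof -
  have "char (uniform_measure lborel {0..1}) \<theta> = (\<integral>x. indicator {0..1} x *\<^sub>R iexp (\<theta> * x) \<partial>lborel)"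
  proof -
    have "uniform_measure lborel {0..1} = density lborel (\<lambda>x::real. ennreal (indicator {0..1} x))"
      unfolding uniform_measure_def by (intro density_cong AE_I2) (auto simp: ennreal_indicator split: split_indicator)
    then show ?thesis unfolding char_def by (simp only:) (subst integral_density; simp)
  qed
  also have "\<dots> = mean_iexp \<theta>"
  proof (cases "\<theta> = 0")
    case True
    then show ?thesis by simp
  next
    case False
    have "(\<integral>x. indicator {0..1} x *\<^sub>R iexp (\<theta> * x) \<partial>lborel) =
        iexp (\<theta> * 1) / (\<i> * \<theta>) - iexp (\<theta> * 0) / (\<i> * \<theta>)"
    proof (rule integral_FTC_Icc)
      fix x :: real
      have i2: "- (\<i> * (z * \<i>)) = z" for z by (simp add: complex_eq_iff)
      show "((\<lambda>x. iexp (\<theta> * x) / (\<i> * \<theta>)) has_vector_derivative iexp (\<theta> * x)) (at x within {0..1})"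
        unfolding of_real_mult using False
        by (intro has_vector_derivative_real_field[where f = "\<lambda>z. exp (\<i> * (\<theta> * z)) / (\<i> * \<theta>)"])
          (auto intro!: derivative_eq_intros simp: i2)
    qed (auto intro!: continuous_intros)
    then show ?thesis using False by (simp add: mean_iexp_def diff_divide_distrib)
  qed
  finally show ?thesis .
qed

lemma prob_space_unit_interval: "prob_space (uniform_measure lborel {0..1::real})"
  by (rule prob_space_uniform_measure) auto

definition grid :: "nat \<Rightarrow> real set" where
  "grid m = (\<lambda>j. real j / real m) ` {..<m}"

lemma card_grid: "0 < m \<Longrightarrow> card (grid m) = m"
  unfolding grid_def by (subst card_image) (auto simp: inj_on_def)

text \<open>
  The uniform law on the grid plus a uniform law on \<open>[0, 1 / m]\<close> is uniform on \<open>[0, 1]\<close>; in terms of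
  characteristic functions this is the formula for a geometric sum.
\<close>
lemma char_uniform_grid:
  assumes m: "0 < m"
  shows "mean_iexp (\<theta> * (1 / m)) * char (distr (uniform_count_measure (grid m)) borel (\<lambda>x. x)) \<theta> = mean_iexp \<theta>"
proof -
  have fin: "finite (grid m)" by (simp add: grid_def)
  define z where "z = iexp (\<theta> / m)"
  have "char (distr (uniform_count_measure (grid m)) borel (\<lambda>x. x)) \<theta> =
      (\<integral>x. iexp (\<theta> * x) \<partial>uniform_count_measure (grid m))"
    unfolding char_def by (rule integral_distr) (auto simp: uniform_count_measure_def point_measure_def)
  also have "\<dots> = (\<Sum>x\<in>grid m. iexp (\<theta> * x)) / m"
    unfolding uniform_count_measure_def
    by (subst lebesgue_integral_point_measure_finite)
      (auto simp: fin card_grid[OF m] scaleR_conv_of_real sum_distrib_left divide_inverse mult.commute)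
  also have "(\<Sum>x\<in>grid m. iexp (\<theta> * x)) = (\<Sum>j<m. z ^ j)"
    unfolding grid_def
    by (subst sum.reindex) (auto simp: inj_on_def m z_def exp_of_nat_mult[symmetric] intro!: sum.cong arg_cong[where f=exp])
  finally have c: "char (distr (uniform_count_measure (grid m)) borel (\<lambda>x. x)) \<theta> = (\<Sum>j<m. z ^ j) / m" .
  show ?thesis
  proof (cases "\<theta> = 0")
    case True
    then show ?thesis using m c by (simp add: z_def)
  next
    case False
    have "\<i> * \<theta> * (mean_iexp (\<theta> * (1 / m)) * ((\<Sum>j<m. z ^ j) / m)) = (\<i> * (\<theta> / m) * mean_iexp (\<theta> / m)) * (\<Sum>j<m. z ^ j)"
      by simp
    also have "\<dots> = (z - 1) * (\<Sum>j<m. z ^ j)"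
      using mean_iexp_mult[of "\<theta> / m"] by (simp add: z_def)
    also have "\<dots> = z ^ m - 1" by (simp add: power_diff_1_eq)
    also have "z ^ m = iexp \<theta>"
      using m by (simp add: z_def exp_of_nat_mult[symmetric])
    also have "iexp \<theta> - 1 = \<i> * \<theta> * mean_iexp \<theta>" by (rule mean_iexp_mult[symmetric])
    finally have "\<i> * \<theta> * (mean_iexp (\<theta> * (1 / m)) * ((\<Sum>j<m. z ^ j) / m)) = \<i> * \<theta> * mean_iexp \<theta>" .
    then show ?thesis unfolding c using False by (subst (asm) mult_left_cancel) auto
  qed
qed

section \<open>Conditional rank along a sequence of bits\<close>

text \<open>
  The first \<open>k\<close> bits read as a binary number, the first bit being the most significant one. So numeric
  order is lexicographic order, and the words that extend \<open>w\<close> by one bit are \<open>2 * w\<close> and \<open>2 * w + 1\<close>.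
\<close>
primrec word :: "(nat \<Rightarrow> 'a \<Rightarrow> nat) \<Rightarrow> nat \<Rightarrow> 'a \<Rightarrow> nat" where
  "word b 0 \<omega> = 0"
| "word b (Suc k) \<omega> = 2 * word b k \<omega> + b k \<omega>"

lemma word_measurable:
  assumes "\<And>i. b i \<in> measurable G (count_space UNIV)"
  shows "word b k \<in> measurable G (count_space UNIV)"
proof (induction k)
  case 0
  have "word b 0 = (\<lambda>_. 0)" by auto
  then show ?case by simp
next
  case (Suc k)
  note [measurable] = Suc assms
  have "word b (Suc k) = (\<lambda>\<omega>. 2 * word b k \<omega> + b k \<omega>)" by auto
  also have "\<dots> \<in> measurable G (count_space UNIV)" by measurable
  finally show ?case .
qed

text \<open>
  The cells \<open>{word b k = w}\<close> form an increasing sequence of finite partitions. In each of them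
  \<open>low k w\<close> is the conditional probability of all cells to the left of \<open>w\<close>; \<open>rank_at k\<close> and \<open>mass_at k\<close>
  are the left endpoint and the length of the tile \<open>[low k w, low k (Suc w)]\<close> of the cell that occurs.
\<close>
locale refining_words = conditioning M F for M :: "'a measure" and F +
  fixes b :: "nat \<Rightarrow> 'a \<Rightarrow> nat"
  assumes b_measurable: "\<And>i. b i \<in> measurable M (count_space UNIV)"
    and b_le: "\<And>i \<omega>. \<omega> \<in> space M \<Longrightarrow> b i \<omega> \<le> 1"
begin

definition cell :: "nat \<Rightarrow> nat \<Rightarrow> 'a set" where
  "cell k w = {\<omega>\<in>space M. word b k \<omega> = w}"

definition low :: "nat \<Rightarrow> nat \<Rightarrow> 'a \<Rightarrow> real" where
  "low k w \<omega> = (\<Sum>v<w. cprob (cell k v) \<omega>)"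

definition mass_at :: "nat \<Rightarrow> 'a \<Rightarrow> real" where
  "mass_at k \<omega> = cprob (cell k (word b k \<omega>)) \<omega>"

definition rank_at :: "nat \<Rightarrow> 'a \<Rightarrow> real" where
  "rank_at k \<omega> = low k (word b k \<omega>) \<omega>"

definition mass :: "'a \<Rightarrow> real" where
  "mass \<omega> = lim (\<lambda>k. mass_at k \<omega>)"

definition rank :: "'a \<Rightarrow> real" where
  "rank \<omega> = lim (\<lambda>k. rank_at k \<omega>)"

lemma word_less: "\<omega> \<in> space M \<Longrightarrow> word b k \<omega> < 2 ^ k"
proof (induction k)
  case (Suc k)
  then show ?case using b_le[of \<omega> k] by auto
qed simp

lemma word_meas [measurable]: "word b k \<in> measurable M (count_space UNIV)"
  by (rule word_measurable[OF b_measurable])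

lemma cell_events [measurable]: "cell k w \<in> events"
  unfolding cell_def by measurable

lemma cell_split: "cell k w = cell (Suc k) (2 * w) \<union> cell (Suc k) (2 * w + 1)"
proof -
  have "b k \<omega> = 0 \<or> b k \<omega> = 1" if "\<omega> \<in> space M" for \<omega>
    using b_le[OF that, of k] by auto
  then have "word b k \<omega> = w \<longleftrightarrow> word b (Suc k) \<omega> = 2 * w \<or> word b (Suc k) \<omega> = 2 * w + 1"
    if "\<omega> \<in> space M" for \<omega>
    using that[THEN \<open>\<And>\<omega>. \<omega> \<in> space M \<Longrightarrow> b k \<omega> = 0 \<or> b k \<omega> = 1\<close>] by auto
  then show ?thesis unfolding cell_def by blast
qed

lemma low_measurable [measurable]: "low k w \<in> borel_measurable F" "low k w \<in> borel_measurable M"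
  unfolding low_def[abs_def] by measurable

lemma mass_at_measurable:
  assumes "subalgebra G F" "\<And>i. b i \<in> measurable G (count_space UNIV)"
  shows "mass_at k \<in> borel_measurable G"
  unfolding mass_at_def[abs_def]
  using word_measurable[OF assms(2)] measurable_from_subalg[OF assms(1) cprob_measurable(1)]
  by (intro measurable_compose_countable[where f="\<lambda>w. cprob (cell k w)" and g="word b k"]) auto

lemma rank_at_measurable:
  assumes "subalgebra G F" "\<And>i. b i \<in> measurable G (count_space UNIV)"
  shows "rank_at k \<in> borel_measurable G"
  unfolding rank_at_def[abs_def]
  using word_measurable[OF assms(2)] measurable_from_subalg[OF assms(1) low_measurable(1)]
  by (intro measurable_compose_countable[where f="\<lambda>w. low k w" and g="word b k"]) auto

lemma mass_measurable:
  assumes "subalgebra G F" "\<And>i. b i \<in> measurable G (count_space UNIV)"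
  shows "mass \<in> borel_measurable G"
  unfolding mass_def[abs_def] using mass_at_measurable[OF assms] by (rule borel_measurable_lim_metric)

lemma rank_measurable:
  assumes "subalgebra G F" "\<And>i. b i \<in> measurable G (count_space UNIV)"
  shows "rank \<in> borel_measurable G"
  unfolding rank_def[abs_def] using rank_at_measurable[OF assms] by (rule borel_measurable_lim_metric)

lemmas mass_at_meas [measurable] = mass_at_measurable[OF subalg b_measurable]
lemmas rank_at_meas [measurable] = rank_at_measurable[OF subalg b_measurable]
lemmas mass_meas [measurable] = mass_measurable[OF subalg b_measurable]
lemmas rank_meas [measurable] = rank_measurable[OF subalg b_measurable]

text \<open>
  Conditional probabilities satisfy their expected identities almost everywhere only. There are countably
  many cells, so outside one null set the tiles really are nested partitions of \<open>[0, 1]\<close>.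
\<close>
definition coherent :: "'a \<Rightarrow> bool" where
  "coherent \<omega> \<longleftrightarrow> \<omega> \<in> space M \<and> cprob (cell 0 0) \<omega> = 1 \<and>
     (\<forall>k w. 0 \<le> cprob (cell k w) \<omega> \<and>
       cprob (cell k w) \<omega> = cprob (cell (Suc k) (2 * w)) \<omega> + cprob (cell (Suc k) (2 * w + 1)) \<omega>)"

lemma AE_coherent: "AE \<omega> in M. coherent \<omega>"
proof -
  have "cell 0 0 = space M" by (auto simp: cell_def)
  then have 1: "AE \<omega> in M. cprob (cell 0 0) \<omega> = 1"
    using cprob_F[of "space M"] subalg sets.top[of F] by (auto simp: subalgebra_def)
  have 2: "AE \<omega> in M. \<forall>k w. 0 \<le> cprob (cell k w) \<omega>"
    by (simp add: AE_all_countable cprob_nonneg)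
  have "AE \<omega> in M. cprob (cell k w) \<omega> = cprob (cell (Suc k) (2 * w)) \<omega> + cprob (cell (Suc k) (2 * w + 1)) \<omega>"
    for k w
  proof (subst cell_split, rule cprob_union)
    show "cell (Suc k) (2 * w) \<inter> cell (Suc k) (2 * w + 1) = {}"
      by (simp only: cell_def) force
  qed simp_all
  then have 3: "AE \<omega> in M. \<forall>k w. cprob (cell k w) \<omega> = cprob (cell (Suc k) (2 * w)) \<omega> + cprob (cell (Suc k) (2 * w + 1)) \<omega>"
    by (simp only: AE_all_countable) blast
  from AE_space 1 2 3 show ?thesis unfolding coherent_def by eventually_elim blast
qed

context
  fixes \<omega> assumes coh: "coherent \<omega>"
begin

lemma coherent_space: "\<omega> \<in> space M" and coherent_total: "cprob (cell 0 0) \<omega> = 1"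
  using coh unfolding coherent_def by blast+

lemma cell_nonneg: "0 \<le> cprob (cell k w) \<omega>"
  using coh unfolding coherent_def by blast

lemma cell_sum:
  "cprob (cell k w) \<omega> = cprob (cell (Suc k) (2 * w)) \<omega> + cprob (cell (Suc k) (2 * w + 1)) \<omega>"
  using coh unfolding coherent_def by blast

lemma low_Suc: "low k (Suc w) \<omega> = low k w \<omega> + cprob (cell k w) \<omega>"
  by (simp add: low_def)

lemma low_double: "low (Suc k) (2 * w) \<omega> = low k w \<omega>"
proof (induction w)
  case (Suc w)
  have "low (Suc k) (2 * Suc w) \<omega> = low (Suc k) (2 * w) \<omega> + cprob (cell (Suc k) (2 * w)) \<omega> + cprob (cell (Suc k) (2 * w + 1)) \<omega>"
    by (simp add: low_Suc)
  with Suc cell_sum[of k w] show ?case by (simp only: low_Suc)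
qed (simp add: low_def)

lemma low_total: "low k (2 ^ k) \<omega> = 1"
proof (induction k)
  case 0
  then show ?case by (simp add: low_def coherent_total)
next
  case (Suc k)
  then show ?case using low_double[of k "2 ^ k"] by simp
qed

lemma low_mono: "v \<le> w \<Longrightarrow> low k v \<omega> \<le> low k w \<omega>"
  unfolding low_def by (rule sum_mono2) (auto simp: cell_nonneg)

lemma low_bounds: "0 \<le> low k w \<omega>" "w \<le> 2 ^ k \<Longrightarrow> low k w \<omega> \<le> 1"
  using low_mono[of 0 w k] low_mono[of w "2^k" k] low_total[of k] by (auto simp: low_def)

lemma rank_plus_mass: "rank_at k \<omega> + mass_at k \<omega> = low k (Suc (word b k \<omega>)) \<omega>"
  by (simp add: rank_at_def mass_at_def low_Suc)

lemma rank_at_Suc: "rank_at k \<omega> \<le> rank_at (Suc k) \<omega>"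
  using low_mono[of "2 * word b k \<omega>" "word b (Suc k) \<omega>" "Suc k"]
  by (simp add: rank_at_def low_double)

lemma rank_plus_mass_Suc: "rank_at (Suc k) \<omega> + mass_at (Suc k) \<omega> \<le> rank_at k \<omega> + mass_at k \<omega>"
proof -
  have "Suc (word b (Suc k) \<omega>) \<le> 2 * Suc (word b k \<omega>)"
    using b_le[OF coherent_space, of k] by simp
  from low_mono[OF this, of "Suc k"] show ?thesis
    unfolding rank_plus_mass by (simp only: low_double)
qed

lemma word_le: "Suc (word b k \<omega>) \<le> 2 ^ k"
  using word_less[OF coherent_space, of k] by simp

lemma mass_at_bounds: "0 \<le> mass_at k \<omega>" "mass_at k \<omega> \<le> 1"
  using low_bounds(2)[OF word_le, of k] low_bounds(1)[of k "word b k \<omega>"] cell_nonneg rank_plus_mass[of k]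
  by (auto simp: mass_at_def rank_at_def)

lemma rank_at_bounds: "0 \<le> rank_at k \<omega>" "rank_at k \<omega> \<le> 1"
  using low_bounds(1)[of k "word b k \<omega>"] low_bounds(2)[of "word b k \<omega>" k] word_le[of k] by (auto simp: rank_at_def)

lemma mass_at_Suc: "mass_at (Suc k) \<omega> \<le> mass_at k \<omega>"
  using rank_plus_mass_Suc[of k] rank_at_Suc[of k] by simp

lemma rank_at_tendsto: "(\<lambda>k. rank_at k \<omega>) \<longlonglongrightarrow> rank \<omega>"
proof -
  have "convergent (\<lambda>k. rank_at k \<omega>)"
    using rank_at_bounds rank_at_Suc
    by (intro Bseq_monoseq_convergent BseqI'[of _ 1]) (auto simp: monoseq_Suc)
  then show ?thesis unfolding rank_def by (simp add: convergent_LIMSEQ_iff)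
qed

lemma mass_at_tendsto: "(\<lambda>k. mass_at k \<omega>) \<longlonglongrightarrow> mass \<omega>"
proof -
  have "convergent (\<lambda>k. mass_at k \<omega>)"
    using mass_at_bounds mass_at_Suc
    by (intro Bseq_monoseq_convergent BseqI'[of _ 1]) (auto simp: monoseq_Suc)
  then show ?thesis unfolding mass_def by (simp add: convergent_LIMSEQ_iff)
qed

lemma rank_ge: "rank_at k \<omega> \<le> rank \<omega>"
  by (rule incseq_le[OF _ rank_at_tendsto]) (simp add: incseq_SucI rank_at_Suc)

lemma rank_plus_mass_le: "rank \<omega> + mass \<omega> \<le> rank_at k \<omega> + mass_at k \<omega>"
  by (rule decseq_ge[OF _ tendsto_add[OF rank_at_tendsto mass_at_tendsto], of k])
    (simp add: decseq_SucI rank_plus_mass_Suc)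

lemma mass_bounds: "0 \<le> mass \<omega>" "mass \<omega> \<le> 1"
  using LIMSEQ_le_const[OF mass_at_tendsto, of 0] LIMSEQ_le_const2[OF mass_at_tendsto, of 1] mass_at_bounds
  by auto

end

end

section \<open>Law of the rank\<close>

context refining_words
begin

text \<open>
  The Fourier integral of a tile is the difference of the exponentials at its endpoints, divided by
  \<open>\<i> * \<theta>\<close>; the tiles are adjacent and cover \<open>[0, 1]\<close>.
\<close>
lemma telescoping_cells:
  assumes coh: "coherent \<omega>"
  shows "(\<Sum>w<2 ^ k. iexp (\<theta> * low k w \<omega>) * mean_iexp (\<theta> * cprob (cell k w) \<omega>) * cprob (cell k w) \<omega>) =
    mean_iexp \<theta>" (is "?S = _")
proof (cases "\<theta> = 0")
  case True
  then show ?thesis using low_total[OF coh, of k] by (simp add: low_def flip: of_real_sum)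
next
  case False
  have "\<i> * \<theta> * ?S = (\<Sum>w<2 ^ k. iexp (\<theta> * low k (Suc w) \<omega>) - iexp (\<theta> * low k w \<omega>))"
    unfolding sum_distrib_left
  proof (rule sum.cong)
    fix w
    let ?q = "cprob (cell k w) \<omega>"
    have "\<i> * \<theta> * (iexp (\<theta> * low k w \<omega>) * mean_iexp (\<theta> * ?q) * ?q) =
        iexp (\<theta> * low k w \<omega>) * (\<i> * (\<theta> * ?q) * mean_iexp (\<theta> * ?q))" by simp
    also have "\<dots> = iexp (\<theta> * low k w \<omega>) * (iexp (\<theta> * ?q) - 1)"
      using mean_iexp_mult[of "\<theta> * ?q"] by simp
    also have "\<dots> = iexp (\<theta> * low k (Suc w) \<omega>) - iexp (\<theta> * low k w \<omega>)"
      by (simp add: low_Suc[OF coh] ring_distribs exp_add)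
    finally show "\<i> * \<theta> * (iexp (\<theta> * low k w \<omega>) * mean_iexp (\<theta> * ?q) * ?q) =
      iexp (\<theta> * low k (Suc w) \<omega>) - iexp (\<theta> * low k w \<omega>)" .
  qed simp
  also have "\<dots> = iexp (\<theta> * low k (2 ^ k) \<omega>) - iexp (\<theta> * low k 0 \<omega>)"
    by (rule sum_lessThan_telescope)
  also have "\<dots> = \<i> * \<theta> * mean_iexp \<theta>"
    by (simp only: low_total[OF coh]) (simp add: low_def mean_iexp_mult)
  finally show ?thesis using False by simp
qed

text \<open>
  Rank and mass take on the cell \<open>w\<close> values measurable with respect to \<open>F\<close>. So, under an integral over an
  event of \<open>F\<close>, the indicator of the cell can be replaced by its conditional probability, and the
  resulting sum telescopes.
\<close>
lemma char_rank_at: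
  assumes A: "A \<in> sets F"
  shows "(\<integral>\<omega>. indicator A \<omega> *\<^sub>R (iexp (\<theta> * rank_at k \<omega>) * mean_iexp (\<theta> * mass_at k \<omega>)) \<partial>M) =
    prob A * mean_iexp \<theta>"
proof -
  have [measurable]: "A \<in> sets M" using A by (rule F_events)
  define f where "f w \<omega> = indicator A \<omega> *\<^sub>R (iexp (\<theta> * low k w \<omega>) * mean_iexp (\<theta> * cprob (cell k w) \<omega>))" for w \<omega>
  have f[measurable]: "f w \<in> borel_measurable F" for w
    unfolding f_def[abs_def] using A by measurable
  have [measurable]: "f w \<in> borel_measurable M" for w
    using f measurable_from_subalg[OF subalg] by blast
  have f_le: "norm (f w \<omega>) \<le> 1" for w \<omega>
    using norm_mean_iexp_le by (auto simp: f_def norm_mult split: split_indicator)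
  have int1: "integrable M (\<lambda>\<omega>. f w \<omega> * indicator (cell k w) \<omega>)" for w
    using f_le by (intro integrable_const_bound[of _ 1] AE_I2) (auto split: split_indicator)
  have int2: "integrable M (\<lambda>\<omega>. f w \<omega> * cprob (cell k w) \<omega>)" for w
  proof (rule integrable_const_bound[of _ 1])
    show "AE \<omega> in M. norm (f w \<omega> * cprob (cell k w) \<omega>) \<le> 1"
      using cprob_bounds[OF cell_events[of k w]]
    proof eventually_elim
      case (elim \<omega>)
      show ?case using mult_mono[OF f_le[of w \<omega>] elim] by (simp add: norm_mult)
    qed
  qed measurable
  have "indicator A \<omega> *\<^sub>R (iexp (\<theta> * rank_at k \<omega>) * mean_iexp (\<theta> * mass_at k \<omega>)) =
      (\<Sum>w<2 ^ k. f w \<omega> * indicator (cell k w) \<omega>)" if "\<omega> \<in> space M" for \<omega>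
  proof -
    have "(\<Sum>w<2 ^ k. f w \<omega> * indicator (cell k w) \<omega>) =
        (\<Sum>w<2 ^ k. if w = word b k \<omega> then f w \<omega> else 0)"
      using that by (intro sum.cong) (auto simp: cell_def)
    also have "\<dots> = f (word b k \<omega>) \<omega>"
      using word_less[OF that, of k] by simp
    finally show ?thesis by (simp add: f_def rank_at_def mass_at_def)
  qed
  then have "(\<integral>\<omega>. indicator A \<omega> *\<^sub>R (iexp (\<theta> * rank_at k \<omega>) * mean_iexp (\<theta> * mass_at k \<omega>)) \<partial>M) =
      (\<integral>\<omega>. (\<Sum>w<2 ^ k. f w \<omega> * indicator (cell k w) \<omega>) \<partial>M)"
    by (intro Bochner_Integration.integral_cong) auto
  also have "\<dots> = (\<Sum>w<2 ^ k. \<integral>\<omega>. f w \<omega> * indicator (cell k w) \<omega> \<partial>M)"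
    using int1 by (rule Bochner_Integration.integral_sum)
  also have "\<dots> = (\<Sum>w<2 ^ k. \<integral>\<omega>. f w \<omega> * cprob (cell k w) \<omega> \<partial>M)"
    by (intro sum.cong refl integral_cprob_mult_complex[OF cell_events f f_le])
  also have "\<dots> = (\<integral>\<omega>. (\<Sum>w<2 ^ k. f w \<omega> * cprob (cell k w) \<omega>) \<partial>M)"
    using int2 by (rule Bochner_Integration.integral_sum[symmetric])
  also have "\<dots> = (\<integral>\<omega>. indicator A \<omega> *\<^sub>R mean_iexp \<theta> \<partial>M)"
  proof (rule integral_cong_AE)
    show "AE \<omega> in M. (\<Sum>w<2 ^ k. f w \<omega> * cprob (cell k w) \<omega>) = indicator A \<omega> *\<^sub>R mean_iexp \<theta>"
      using AE_coherent
    proof eventually_elim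
      case (elim \<omega>)
      have "(\<Sum>w<2 ^ k. f w \<omega> * cprob (cell k w) \<omega>) = indicator A \<omega> *\<^sub>R
          (\<Sum>w<2 ^ k. iexp (\<theta> * low k w \<omega>) * mean_iexp (\<theta> * cprob (cell k w) \<omega>) * cprob (cell k w) \<omega>)"
        by (simp add: f_def scaleR_sum_right)
      then show ?case by (simp only: telescoping_cells[OF elim])
    qed
  qed measurable
  also have "\<dots> = prob A * mean_iexp \<theta>"
    by (simp add: scaleR_conv_of_real)
  finally show ?thesis .
qed

lemma char_rank:
  assumes A: "A \<in> sets F" and p: "AE \<omega> in M. mass \<omega> = p"
  shows "mean_iexp (\<theta> * p) * (\<integral>\<omega>. indicator A \<omega> *\<^sub>R iexp (\<theta> * rank \<omega>) \<partial>M) = prob A * mean_iexp \<theta>"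
proof -
  have [measurable]: "A \<in> sets M" using A by (rule F_events)
  have "(\<lambda>k. \<integral>\<omega>. indicator A \<omega> *\<^sub>R (iexp (\<theta> * rank_at k \<omega>) * mean_iexp (\<theta> * mass_at k \<omega>)) \<partial>M)
     \<longlonglongrightarrow> (\<integral>\<omega>. indicator A \<omega> *\<^sub>R (iexp (\<theta> * rank \<omega>) * mean_iexp (\<theta> * p)) \<partial>M)"
  proof (rule integral_dominated_convergence[where w = "\<lambda>_. 1"])
    show "AE \<omega> in M. (\<lambda>k. indicator A \<omega> *\<^sub>R (iexp (\<theta> * rank_at k \<omega>) * mean_iexp (\<theta> * mass_at k \<omega>)))
        \<longlonglongrightarrow> indicator A \<omega> *\<^sub>R (iexp (\<theta> * rank \<omega>) * mean_iexp (\<theta> * p))"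
      using AE_coherent p
    proof eventually_elim
      case (elim \<omega>)
      then have "(\<lambda>k. mass_at k \<omega>) \<longlonglongrightarrow> p" using mass_at_tendsto by auto
      then show ?case using rank_at_tendsto[OF elim(1)]
        by (intro tendsto_intros isCont_tendsto_compose[OF isCont_mean_iexp])
    qed
    show "AE \<omega> in M. norm (indicator A \<omega> *\<^sub>R (iexp (\<theta> * rank_at k \<omega>) * mean_iexp (\<theta> * mass_at k \<omega>))) \<le> 1" for k
      using norm_mean_iexp_le by (intro AE_I2) (auto simp: norm_mult split: split_indicator)
  qed simp_all
  then have "(\<integral>\<omega>. indicator A \<omega> *\<^sub>R (iexp (\<theta> * rank \<omega>) * mean_iexp (\<theta> * p)) \<partial>M) = prob A * mean_iexp \<theta>"
    unfolding char_rank_at[OF A] by (simp add: LIMSEQ_const_iff)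
  moreover have "(\<integral>\<omega>. indicator A \<omega> *\<^sub>R (iexp (\<theta> * rank \<omega>) * mean_iexp (\<theta> * p)) \<partial>M) =
      (\<integral>\<omega>. indicator A \<omega> *\<^sub>R iexp (\<theta> * rank \<omega>) \<partial>M) * mean_iexp (\<theta> * p)"
    by (subst integral_mult_left_zero[symmetric]) simp
  ultimately show ?thesis by (simp add: mult.commute)
qed

definition rank_law_given :: "'a set \<Rightarrow> real measure" where
  "rank_law_given A = distr (uniform_measure M A) borel rank"

lemma char_rank_law_given:
  assumes A: "A \<in> sets F" "prob A \<noteq> 0" and p: "AE \<omega> in M. mass \<omega> = p"
  shows "mean_iexp (\<theta> * p) * char (rank_law_given A) \<theta> = mean_iexp \<theta>"
proof -
  have [measurable]: "A \<in> sets M" using A(1) by (rule F_events)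
  have "char (rank_law_given A) \<theta> = (\<integral>\<omega>. iexp (\<theta> * rank \<omega>) \<partial>uniform_measure M A)"
    unfolding char_def rank_law_given_def by (rule integral_distr) auto
  also have "uniform_measure M A = density M (\<lambda>\<omega>. ennreal (indicator A \<omega> / prob A))"
    unfolding uniform_measure_def using A(2)
    by (intro density_cong AE_I2)
      (auto simp: emeasure_eq_measure divide_ennreal measure_nonneg less_le simp flip: ennreal_indicator)
  also have "(\<integral>\<omega>. iexp (\<theta> * rank \<omega>) \<partial>\<dots>) = (\<integral>\<omega>. (indicator A \<omega> / prob A) *\<^sub>R iexp (\<theta> * rank \<omega>) \<partial>M)"
    by (rule integral_density) auto
  also have "\<dots> = (\<integral>\<omega>. inverse (prob A) *\<^sub>R indicator A \<omega> *\<^sub>R iexp (\<theta> * rank \<omega>) \<partial>M)"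
    by (simp add: divide_inverse mult.commute)
  also have "\<dots> = inverse (prob A) *\<^sub>R (\<integral>\<omega>. indicator A \<omega> *\<^sub>R iexp (\<theta> * rank \<omega>) \<partial>M)"
    by (rule integral_scaleR_right)
  finally have "mean_iexp (\<theta> * p) * char (rank_law_given A) \<theta> =
      inverse (prob A) * (mean_iexp (\<theta> * p) * (\<integral>\<omega>. indicator A \<omega> *\<^sub>R iexp (\<theta> * rank \<omega>) \<partial>M))"
    by (simp add: scaleR_conv_of_real mult_ac)
  then show ?thesis unfolding char_rank[OF A(1) p] using A(2) by simp
qed

lemma real_distribution_rank_law_given:
  assumes "A \<in> events" "prob A \<noteq> 0"
  shows "real_distribution (rank_law_given A)"
proof -
  interpret A: prob_space "uniform_measure M A"
    using assms by (intro prob_space_uniform_measure) (auto simp: emeasure_eq_measure)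
  show ?thesis unfolding rank_law_given_def by (intro A.real_distribution_distr) simp
qed

lemma rank_law_given_space: "rank_law_given (space M) = distr M borel rank"
proof -
  have "uniform_measure M (space M) = density M (\<lambda>_. 1)"
    unfolding uniform_measure_def by (intro density_cong) (auto simp: emeasure_space_1)
  then show ?thesis by (simp add: rank_law_given_def density_1)
qed

lemma space_F: "space M \<in> sets F"
  using subalg sets.top[of F] by (auto simp: subalgebra_def)

lemma rank_law_given_eq:
  assumes "A \<in> sets F" "prob A \<noteq> 0" and p: "AE \<omega> in M. mass \<omega> = p"
  shows "rank_law_given A = distr M borel rank"
  unfolding rank_law_given_space[symmetric]
  using assms char_rank_law_given[OF assms] char_rank_law_given[OF space_F _ p]
    real_distribution_rank_law_given[OF F_events[OF assms(1)]]
    real_distribution_rank_law_given[OF sets.top]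
  by (intro char_quotient_unique[of _ _ p]) (auto simp: prob_space)

text \<open>
  The conditional law of the rank given any non-null event of \<open>F\<close> solves the same Fourier equation, which
  has only one solution.
\<close>
lemma rank_indep:
  assumes p: "AE \<omega> in M. mass \<omega> = p" and A: "A \<in> sets F" and B: "B \<in> sets borel"
  shows "prob (A \<inter> (rank -` B \<inter> space M)) = prob A * prob (rank -` B \<inter> space M)"
proof (cases "prob A = 0")
  case True
  then show ?thesis using F_events[OF A] B measurable_sets[OF rank_meas B]
    by (metis finite_measure_mono inf.cobounded1 measure_le_0_iff mult_zero_left)
next
  case False
  have "measure (rank_law_given A) B = prob (A \<inter> (rank -` B \<inter> space M)) / prob A"
    unfolding rank_law_given_def using B False F_events[OF A] measurable_sets[OF rank_meas B]
    by (subst measure_distr) (auto simp: emeasure_eq_measure)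
  moreover have "measure (rank_law_given A) B = prob (rank -` B \<inter> space M)"
    unfolding rank_law_given_eq[OF A False p] using B by (simp add: measure_distr)
  ultimately show ?thesis using False by (simp add: field_simps)
qed

lemma rank_uniform_interval:
  assumes p: "AE \<omega> in M. mass \<omega> = 0"
  shows "distr M borel rank = uniform_measure lborel {0..1}"
proof (rule char_quotient_unique[of _ _ 0])
  show "real_distribution (distr M borel rank)" by (intro real_distribution_distr) simp
  interpret U: prob_space "uniform_measure lborel {0..1::real}" by (rule prob_space_unit_interval)
  show "real_distribution (uniform_measure lborel {0..1})" by unfold_locales auto
qed (use char_rank_law_given[OF space_F _ p] in \<open>auto simp: prob_space rank_law_given_space char_uniform_unit_interval\<close>)

text \<open>
  At \<open>\<theta> = 2 * pi / p\<close> the factor \<open>mean_iexp (\<theta> * p)\<close> vanishes, hence so does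
  \<open>mean_iexp (2 * pi / p)\<close>, which says that \<open>1 / p\<close> is an integer.
\<close>
lemma rank_uniform_grid:
  assumes p: "AE \<omega> in M. mass \<omega> = p" and "p \<noteq> 0"
  obtains m where "0 < m" "p = 1 / real m"
    "distr M borel rank = distr (uniform_count_measure (grid m)) borel (\<lambda>x. x)"
proof -
  note c = char_rank_law_given[OF space_F _ p, unfolded rank_law_given_space prob_space, simplified]
  have "AE \<omega> in M. 0 < p"
    using p AE_coherent by eventually_elim (use mass_bounds \<open>p \<noteq> 0\<close> in \<open>auto simp: less_le\<close>)
  then have "0 < p" by simp
  have "iexp (2 * pi) = 1" by (simp add: exp_eq_1)
  then have "mean_iexp (2 * pi / p * p) = 0" using \<open>0 < p\<close> by (simp add: mean_iexp_zero_iff)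
  with c[of "2 * pi / p"] have "mean_iexp (2 * pi / p) = 0" by simp
  then have "iexp (2 * pi / p) = 1" unfolding mean_iexp_zero_iff by blast
  then obtain n :: int where "2 * pi / p = of_int (2 * n) * pi"
    unfolding exp_eq_1 by auto
  then have n: "1 / p = of_int n" using \<open>0 < p\<close> by (simp add: field_simps)
  then have "0 < n" using \<open>0 < p\<close> by (metis of_int_0_less_iff zero_less_divide_1_iff)
  define m where "m = nat n"
  have m: "0 < m" "p = 1 / real m"
    using n \<open>0 < n\<close> \<open>0 < p\<close> by (auto simp: m_def field_simps)
  interpret S: prob_space "uniform_count_measure (grid m)"
    using m(1) by (intro prob_space_uniform_count_measure) (auto simp: grid_def)
  have "distr M borel rank = distr (uniform_count_measure (grid m)) borel (\<lambda>x. x)"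
  proof (rule char_quotient_unique[of _ _ p])
    show "real_distribution (distr M borel rank)" by (intro real_distribution_distr) simp
    show "real_distribution (distr (uniform_count_measure (grid m)) borel (\<lambda>x. x))"
      by (intro S.real_distribution_distr) (auto simp: uniform_count_measure_def point_measure_def)
    show "mean_iexp (\<theta> * p) * char (distr (uniform_count_measure (grid m)) borel (\<lambda>x. x)) \<theta> = mean_iexp \<theta>" for \<theta>
      using char_uniform_grid[OF m(1), of \<theta>] by (simp add: m(2))
  qed (rule c)
  with m that show ?thesis by blast
qed

text \<open>
  A diffuse variable avoids any point chosen independently of it.
\<close>
lemma AE_rank_neq:
  assumes p: "AE \<omega> in M. mass \<omega> = 0" and d: "d \<in> borel_measurable F"
  shows "AE \<omega> in M. rank \<omega> \<noteq> d \<omega>"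
proof -
  have d'[measurable]: "d \<in> borel_measurable M" using d measurable_from_subalg[OF subalg] by blast
  have "indep_var borel d borel rank"
    unfolding indep_var_eq
  proof (intro conjI indep_set_sigma_sets indep_setI)
    fix a c assume "a \<in> {d -` A \<inter> space M |A. A \<in> sets borel}" "c \<in> {rank -` A \<inter> space M |A. A \<in> sets borel}"
    then show "prob (a \<inter> c) = prob a * prob c"
      using measurable_sets[OF d] subalg by (auto simp: subalgebra_def intro!: rank_indep[OF p])
  qed (auto simp: measurable_sets intro: Int_stable_vimages)
  then have eq: "distr M borel d \<Otimes>\<^sub>M distr M borel rank = distr M (borel \<Otimes>\<^sub>M borel) (\<lambda>\<omega>. (d \<omega>, rank \<omega>))"
    by (simp add: indep_var_distribution_eq)
  let ?D = "{z :: real \<times> real. fst z = snd z}"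
  have "closed ?D" by (intro closed_Collect_eq continuous_intros)
  then have D: "?D \<in> sets (borel \<Otimes>\<^sub>M borel)"
    unfolding borel_prod by (rule borel_closed)
  interpret R: prob_space "distr M borel rank" by (rule prob_space_distr) simp
  have "emeasure M {\<omega>\<in>space M. rank \<omega> = d \<omega>} = emeasure (distr M borel d \<Otimes>\<^sub>M distr M borel rank) ?D"
    unfolding eq using D by (subst emeasure_distr) (auto intro!: arg_cong[where f="emeasure M"])
  also have "\<dots> = (\<integral>\<^sup>+x. emeasure (distr M borel rank) (Pair x -` ?D) \<partial>distr M borel d)"
    by (rule R.emeasure_pair_measure_alt) (use D in simp)
  also have "\<dots> = (\<integral>\<^sup>+x. 0 \<partial>distr M borel d)"
  proof (rule nn_integral_cong)
    fix x
    have "Pair x -` ?D = {x}" by auto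
    moreover have "emeasure (uniform_measure lborel {0..1::real}) {x} = 0"
    proof -
      have "{0..1} \<inter> {x} \<in> null_sets lborel" by (rule null_sets_subset[of "{x}"]) auto
      then show ?thesis by (subst emeasure_uniform_measure) (auto simp: null_setsD1)
    qed
    ultimately show "emeasure (distr M borel rank) (Pair x -` ?D) = 0"
      by (simp add: rank_uniform_interval[OF p])
  qed
  finally show ?thesis by (subst AE_iff_measurable[OF _ refl]) auto
qed

section \<open>The rank recovers the bits\<close>

text \<open>
  The rank lies between the endpoints of the tile of the cell that occurs. It cannot be the right
  endpoint: for \<open>p > 0\<close> there is still room for the mass \<open>p\<close> to its right, and for \<open>p = 0\<close> the rank is
  diffuse and independent of the endpoints. Half-open tiles are disjoint, so the rank identifies the cell.
\<close>
lemma AE_word_iff_rank: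
  assumes p: "AE \<omega> in M. mass \<omega> = p"
  shows "AE \<omega> in M. \<forall>k. \<forall>w<2 ^ k. word b k \<omega> = w \<longleftrightarrow> low k w \<omega> \<le> rank \<omega> \<and> rank \<omega> < low k (Suc w) \<omega>"
proof -
  have "AE \<omega> in M. \<forall>k. rank \<omega> < low k (Suc (word b k \<omega>)) \<omega>"
  proof (cases "p = 0")
    case True
    have "AE \<omega> in M. \<forall>k w. rank \<omega> \<noteq> low k w \<omega>"
      using AE_rank_neq[OF p[unfolded True]] by (simp add: AE_all_countable)
    with p AE_coherent show ?thesis
    proof eventually_elim
      case (elim \<omega>)
      show ?case
      proof
        fix k
        show "rank \<omega> < low k (Suc (word b k \<omega>)) \<omega>"
          using elim rank_plus_mass_le[OF elim(2), of k] rank_plus_mass[OF elim(2), of k] True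
          by (simp add: less_le)
      qed
    qed
  next
    case False
    show ?thesis using p AE_coherent
    proof eventually_elim
      case (elim \<omega>)
      then have "0 < mass \<omega>" using mass_bounds[OF elim(2)] False by auto
      show ?case
      proof
        fix k
        show "rank \<omega> < low k (Suc (word b k \<omega>)) \<omega>"
          using \<open>0 < mass \<omega>\<close> rank_plus_mass_le[OF elim(2), of k] rank_plus_mass[OF elim(2), of k] by simp
      qed
    qed
  qed
  then show ?thesis using AE_coherent
  proof eventually_elim
    case (elim \<omega>)
    show ?case
    proof (intro allI impI iffI)
      fix k w assume "word b k \<omega> = w"
      then show "low k w \<omega> \<le> rank \<omega> \<and> rank \<omega> < low k (Suc w) \<omega>"
        using elim(1) rank_ge[OF elim(2), of k] by (auto simp: rank_at_def)
    next
      fix k w assume *: "low k w \<omega> \<le> rank \<omega> \<and> rank \<omega> < low k (Suc w) \<omega>"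
      let ?v = "word b k \<omega>"
      have v: "low k ?v \<omega> \<le> rank \<omega>" "rank \<omega> < low k (Suc ?v) \<omega>"
        using elim(1) rank_ge[OF elim(2), of k] by (auto simp: rank_at_def)
      show "?v = w"
      proof (rule antisym; rule ccontr)
        assume "\<not> ?v \<le> w"
        then have "low k (Suc w) \<omega> \<le> low k ?v \<omega>" by (intro low_mono[OF elim(2)]) simp
        with * v show False by simp
      next
        assume "\<not> w \<le> ?v"
        then have "low k (Suc ?v) \<omega> \<le> low k w \<omega>" by (intro low_mono[OF elim(2)]) simp
        with * v show False by simp
      qed
    qed
  qed
qed

section \<open>Refining the cells does not change the limiting mass\<close>

lemma word_prefix:
  assumes "\<omega> \<in> space M" "\<omega>' \<in> space M" "j \<le> k" "word b k \<omega> = word b k \<omega>'"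
  shows "word b j \<omega> = word b j \<omega>'"
  using assms(3,4)
proof (induction rule: inc_induct)
  case (step i)
  then have "word b (Suc i) \<omega> div 2 = word b (Suc i) \<omega>' div 2" by simp
  then show ?case using b_le[OF assms(1), of i] b_le[OF assms(2), of i] by auto
qed

text \<open>
  \<open>outside B k\<close> is the conditional probability of the part of the current cell that lies outside \<open>B\<close>. If the
  cells and \<open>F\<close> together determine \<open>B\<close>, then on \<open>B\<close> this part should become negligible as the cells
  shrink; \<open>leak B k\<close> measures how far this is from being achieved at stage \<open>k\<close>.
\<close>
definition outside :: "'a set \<Rightarrow> nat \<Rightarrow> 'a \<Rightarrow> real" where
  "outside B k \<omega> = cprob (cell k (word b k \<omega>) - B) \<omega>"

definition leak :: "'a set \<Rightarrow> nat \<Rightarrow> real" where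
  "leak B k = (\<integral>\<omega>. indicator B \<omega> * outside B k \<omega> \<partial>M)"

definition resolved :: "'a set \<Rightarrow> bool" where
  "resolved B \<longleftrightarrow> B \<in> events \<and> leak B \<longlonglongrightarrow> 0"

lemma outside_measurable [measurable]: "outside B k \<in> borel_measurable M"
  unfolding outside_def[abs_def]
  by (rule measurable_compose_countable[where f = "\<lambda>w. cprob (cell k w - B)" and g = "word b k"]) measurable

lemma AE_outside_bounds:
  assumes [measurable]: "B \<in> events"
  shows "AE \<omega> in M. 0 \<le> outside B k \<omega> \<and> outside B k \<omega> \<le> 1"
proof -
  have "AE \<omega> in M. \<forall>w. 0 \<le> cprob (cell k w - B) \<omega>" "AE \<omega> in M. \<forall>w. cprob (cell k w - B) \<omega> \<le> 1"
    by (auto simp: AE_all_countable intro!: cprob_nonneg cprob_le_1)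
  then show ?thesis unfolding outside_def by eventually_elim auto
qed

lemma integrable_leak:
  assumes [measurable]: "B \<in> events" "C \<in> events"
  shows "integrable M (\<lambda>\<omega>. indicator C \<omega> * outside B k \<omega>)"
  by (rule integrable_const_bound[of _ 1])
    (use AE_outside_bounds[OF assms(1), of k] in \<open>auto split: split_indicator elim: eventually_mono\<close>)

lemma leak_nonneg: "B \<in> events \<Longrightarrow> 0 \<le> leak B k"
  unfolding leak_def using AE_outside_bounds[of B k]
  by (intro integral_nonneg_AE) (auto elim: eventually_mono)

text \<open>
  The sum is symmetric in \<open>B\<close> and its complement; this is what makes the resolved events closed under
  complements.
\<close>
lemma leak_eq_sum:
  assumes B[measurable]: "B \<in> events"
  shows "leak B k = (\<Sum>w<2 ^ k. \<integral>\<omega>. cprob (cell k w - B) \<omega> * cprob (cell k w \<inter> B) \<omega> \<partial>M)"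
proof -
  have bnd: "AE \<omega> in M. \<bar>cprob (cell k w - B) \<omega>\<bar> \<le> 1" for w
    using cprob_bounds[of "cell k w - B"] by simp
  have int: "integrable M (\<lambda>\<omega>. cprob (cell k w - B) \<omega> * indicator (cell k w \<inter> B) \<omega>)" for w
    by (rule integrable_const_bound[of _ 1]) (use bnd[of w] in \<open>auto split: split_indicator elim: eventually_mono\<close>)
  have "indicator B \<omega> * outside B k \<omega> = (\<Sum>w<2 ^ k. cprob (cell k w - B) \<omega> * indicator (cell k w \<inter> B) \<omega>)"
    if "\<omega> \<in> space M" for \<omega>
  proof -
    have "(\<Sum>w<2 ^ k. cprob (cell k w - B) \<omega> * indicator (cell k w \<inter> B) \<omega>) =
        (\<Sum>w<2 ^ k. if w = word b k \<omega> then cprob (cell k w - B) \<omega> * indicator B \<omega> else 0)"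
      using that by (intro sum.cong) (auto simp: cell_def split: split_indicator)
    also have "\<dots> = cprob (cell k (word b k \<omega>) - B) \<omega> * indicator B \<omega>"
      using word_less[OF that, of k] by simp
    finally show ?thesis by (simp add: outside_def)
  qed
  then have "leak B k = (\<integral>\<omega>. (\<Sum>w<2 ^ k. cprob (cell k w - B) \<omega> * indicator (cell k w \<inter> B) \<omega>) \<partial>M)"
    unfolding leak_def by (intro Bochner_Integration.integral_cong) auto
  also have "\<dots> = (\<Sum>w<2 ^ k. \<integral>\<omega>. cprob (cell k w - B) \<omega> * indicator (cell k w \<inter> B) \<omega> \<partial>M)"
    using int by (rule Bochner_Integration.integral_sum)
  also have "\<dots> = (\<Sum>w<2 ^ k. \<integral>\<omega>. cprob (cell k w - B) \<omega> * cprob (cell k w \<inter> B) \<omega> \<partial>M)"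
    using bnd by (intro sum.cong refl integral_cprob_mult) auto
  finally show ?thesis .
qed

lemma leak_compl:
  assumes B: "B \<in> events"
  shows "leak (space M - B) k = leak B k"
proof -
  have "cell k w - (space M - B) = cell k w \<inter> B" "cell k w \<inter> (space M - B) = cell k w - B" for w
    by (auto simp: cell_def)
  then show ?thesis using B by (simp add: leak_eq_sum mult.commute)
qed

lemma resolved_compl: "resolved B \<Longrightarrow> resolved (space M - B)"
proof -
  assume "resolved B"
  moreover from this have "leak (space M - B) = leak B"
    by (intro ext leak_compl) (simp add: resolved_def)
  ultimately show "resolved (space M - B)" by (auto simp: resolved_def)
qed

lemma resolved_Int:
  assumes "resolved B" "resolved C"
  shows "resolved (B \<inter> C)"
proof -
  have B[measurable]: "B \<in> events" and C[measurable]: "C \<in> events"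
    and lim: "leak B \<longlonglongrightarrow> 0" "leak C \<longlonglongrightarrow> 0"
    using assms by (auto simp: resolved_def)
  have "leak (B \<inter> C) k \<le> leak B k + leak C k" for k
  proof -
    have "AE \<omega> in M. \<forall>w. cprob (cell k w - (B \<inter> C)) \<omega> \<le> cprob (cell k w - B) \<omega> + cprob (cell k w - C) \<omega>"
      unfolding AE_all_countable
    proof
      fix w
      have *: "cell k w - (B \<inter> C) = (cell k w - B) \<union> ((cell k w - C) - (cell k w - B))" by auto
      have "AE \<omega> in M. cprob (cell k w - (B \<inter> C)) \<omega> =
          cprob (cell k w - B) \<omega> + cprob ((cell k w - C) - (cell k w - B)) \<omega>"
        unfolding * by (rule cprob_union) auto
      moreover have "AE \<omega> in M. cprob ((cell k w - C) - (cell k w - B)) \<omega> \<le> cprob (cell k w - C) \<omega>"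
        by (rule cprob_mono) auto
      ultimately show "AE \<omega> in M. cprob (cell k w - (B \<inter> C)) \<omega> \<le> cprob (cell k w - B) \<omega> + cprob (cell k w - C) \<omega>"
        by eventually_elim auto
    qed
    with AE_outside_bounds[OF B, of k] AE_outside_bounds[OF C, of k]
    have "AE \<omega> in M. indicator (B \<inter> C) \<omega> * outside (B \<inter> C) k \<omega> \<le> indicator B \<omega> * outside B k \<omega> + indicator C \<omega> * outside C k \<omega>"
    proof eventually_elim
      case (elim \<omega>)
      from elim(3)[THEN spec, of "word b k \<omega>"] elim(1,2) show ?case
        unfolding outside_def by (simp split: split_indicator)
    qed
    then have "leak (B \<inter> C) k \<le> (\<integral>\<omega>. indicator B \<omega> * outside B k \<omega> + indicator C \<omega> * outside C k \<omega> \<partial>M)"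
      unfolding leak_def by (intro integral_mono_AE Bochner_Integration.integrable_add integrable_leak) auto
    also have "\<dots> = leak B k + leak C k"
      unfolding leak_def by (intro Bochner_Integration.integral_add integrable_leak) auto
    finally show ?thesis .
  qed
  then have le: "\<forall>\<^sub>F k in sequentially. leak (B \<inter> C) k \<le> leak B k + leak C k" by simp
  have ge: "\<forall>\<^sub>F k in sequentially. 0 \<le> leak (B \<inter> C) k" by (simp add: leak_nonneg)
  have "(\<lambda>k. leak B k + leak C k) \<longlonglongrightarrow> 0" using tendsto_add[OF lim] by simp
  from real_tendsto_sandwich[OF ge le tendsto_const this] have "leak (B \<inter> C) \<longlonglongrightarrow> 0" .
  then show ?thesis by (simp add: resolved_def)
qed

lemma resolved_F:
  assumes A: "A \<in> sets F"
  shows "resolved A"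
proof -
  have A'[measurable]: "A \<in> events" using A by (rule F_events)
  have le: "AE \<omega> in M. \<forall>w. cprob (cell k w - A) \<omega> \<le> cprob (space M - A) \<omega>" for k
    unfolding AE_all_countable by (intro allI cprob_mono) (auto simp: cell_def)
  have zero: "AE \<omega> in M. cprob (space M - A) \<omega> = indicator (space M - A) \<omega>"
    using A space_F by (intro cprob_F) auto
  have "AE \<omega> in M. indicator A \<omega> * outside A k \<omega> = 0" for k
    using le[of k] zero AE_outside_bounds[OF A', of k]
  proof eventually_elim
    case (elim \<omega>)
    then show ?case by (cases "\<omega> \<in> A") (auto simp: outside_def intro: antisym)
  qed
  then have "leak A k = 0" for k
    unfolding leak_def by (intro integral_eq_zero_AE)
  then have "leak A = (\<lambda>_. 0)" by auto
  then show ?thesis by (simp add: resolved_def A')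
qed

lemma resolved_cell: "resolved (cell j v)"
proof -
  have zero: "AE \<omega> in M. cprob {} \<omega> = 0" using cprob_F[of "{}"] by auto
  have "leak (cell j v) k = 0" if "j \<le> k" for k
  proof -
    have sub: "cell k (word b k \<omega>) - cell j v = {}" if "\<omega> \<in> cell j v" for \<omega>
      using word_prefix[OF _ _ \<open>j \<le> k\<close>] that by (auto simp: cell_def)
    have "AE \<omega> in M. indicator (cell j v) \<omega> * outside (cell j v) k \<omega> = 0"
      using zero by eventually_elim (auto simp: outside_def sub split: split_indicator)
    then show ?thesis unfolding leak_def by (intro integral_eq_zero_AE)
  qed
  then have "leak (cell j v) \<longlonglongrightarrow> 0"
    by (intro tendsto_eventually eventually_sequentiallyI[of j]) auto
  then show ?thesis by (simp add: resolved_def)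
qed

text \<open>
  Passing from a finite subunion to the whole union increases the leak by at most the probability of
  what has been added.
\<close>
lemma resolved_UN:
  fixes B :: "nat \<Rightarrow> 'a set"
  assumes B: "\<And>i. resolved (B i)"
  shows "resolved (\<Union>i. B i)"
proof -
  have [measurable]: "B i \<in> events" for i using B by (simp add: resolved_def)
  define S where "S n = (\<Union>i<n. B i)" for n :: nat
  have S: "resolved (S n)" for n
  proof (induction n)
    case 0
    show ?case using resolved_F[of "{}"] by (simp add: S_def)
  next
    case (Suc n)
    have "S (Suc n) = space M - ((space M - S n) \<inter> (space M - B n))"
      using sets.sets_into_space[of "S n" M] sets.sets_into_space[of "B n" M]
      unfolding S_def lessThan_Suc by auto
    then show ?case using Suc B by (simp add: resolved_compl resolved_Int)
  qed
  then have Se[measurable]: "S n \<in> events" for n by (simp add: resolved_def)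
  let ?U = "\<Union>i. B i"
  have U: "?U = (\<Union>n. S n)" by (auto simp: S_def)
  have sub: "S n \<subseteq> ?U" for n by (auto simp: S_def)
  have "(\<lambda>n. prob (S n)) \<longlonglongrightarrow> prob (\<Union>n. S n)"
    by (rule finite_Lim_measure_incseq) (auto simp: incseq_def S_def intro: less_le_trans)
  then have lim: "(\<lambda>n. prob ?U - prob (S n)) \<longlonglongrightarrow> 0"
    unfolding U by (auto intro: tendsto_eq_intros)
  have le: "leak ?U k \<le> leak (S n) k + (prob ?U - prob (S n))" for k n
  proof -
    have "AE \<omega> in M. \<forall>w. cprob (cell k w - ?U) \<omega> \<le> cprob (cell k w - S n) \<omega>"
      unfolding AE_all_countable using sub by (auto intro!: cprob_mono)
    moreover have "AE \<omega> in M. 0 \<le> outside ?U k \<omega> \<and> outside ?U k \<omega> \<le> 1"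
      by (rule AE_outside_bounds) auto
    ultimately have "AE \<omega> in M. indicator ?U \<omega> * outside ?U k \<omega> \<le> indicator (S n) \<omega> * outside (S n) k \<omega> + indicator (?U - S n) \<omega>"
    proof eventually_elim
      case (elim \<omega>)
      show ?case
      proof (cases "\<omega> \<in> S n")
        case True
        then have "\<omega> \<in> ?U" using sub by blast
        with True elim(1)[THEN spec, of "word b k \<omega>"] show ?thesis by (simp add: outside_def)
      next
        case False
        then show ?thesis using elim(2) by (auto split: split_indicator)
      qed
    qed
    then have "leak ?U k \<le> (\<integral>\<omega>. indicator (S n) \<omega> * outside (S n) k \<omega> + indicator (?U - S n) \<omega> \<partial>M)"
      unfolding leak_def
      by (intro integral_mono_AE Bochner_Integration.integrable_add integrable_leak integrable_ind) auto
    also have "\<dots> = leak (S n) k + prob (?U - S n)"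
      unfolding leak_def
      by (subst Bochner_Integration.integral_add) (auto intro!: integrable_leak integrable_ind)
    also have "prob (?U - S n) = prob ?U - prob (S n)"
      using sub by (intro finite_measure_Diff) auto
    finally show ?thesis .
  qed
  have "leak ?U \<longlonglongrightarrow> 0"
  proof (rule LIMSEQ_I)
    fix e :: real assume e: "0 < e"
    have "\<forall>\<^sub>F n in sequentially. prob ?U - prob (S n) < e / 2"
      using e by (intro order_tendstoD(2)[OF lim]) auto
    then obtain n where n: "prob ?U - prob (S n) < e / 2"
      by (auto simp: eventually_sequentially)
    have "leak (S n) \<longlonglongrightarrow> 0" using S by (simp add: resolved_def)
    then have "\<forall>\<^sub>F k in sequentially. leak (S n) k < e / 2"
      using e by (intro order_tendstoD(2)) auto
    then obtain N where N: "\<And>k. N \<le> k \<Longrightarrow> leak (S n) k < e / 2"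
      by (auto simp: eventually_sequentially)
    show "\<exists>no. \<forall>k\<ge>no. norm (leak ?U k - 0) < e"
    proof (intro exI[of _ N] allI impI)
      fix k assume "N \<le> k"
      then show "norm (leak ?U k - 0) < e"
        using N[of k] n le[of k n] leak_nonneg[of ?U k] by simp
    qed
  qed
  then show ?thesis by (simp add: resolved_def)
qed

text \<open>
  The resolved events form a \<open>\<sigma>\<close>-algebra that contains \<open>F\<close> and all cells.
\<close>
lemma resolved_sigma:
  assumes "B \<in> sigma_sets (space M) (sets F \<union> {cell k w | k w. True})"
  shows "resolved B"
  using assms
proof induction
  case (Basic a)
  then show ?case using resolved_F resolved_cell by blast
next
  case Empty
  show ?case using resolved_F[of "{}"] by simp
next
  case (Compl a)
  then show ?case using resolved_compl by blast
next
  case (Union a)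
  then show ?case using resolved_UN by blast
qed

text \<open>
  The mass of the cell that occurs when every cell is moreover cut along \<open>B\<close>.
\<close>
definition refined :: "'a set \<Rightarrow> nat \<Rightarrow> 'a \<Rightarrow> real" where
  "refined B k \<omega> = (if \<omega> \<in> B then cprob (cell k (word b k \<omega>) \<inter> B) \<omega> else cprob (cell k (word b k \<omega>) - B) \<omega>)"

text \<open>
  Cutting along \<open>B\<close> removes from the current cell the part on the other side of \<open>B\<close>. Its
  expected conditional probability is the leak of \<open>B\<close> plus the leak of the complement, so in the limit
  nothing is lost if \<open>B\<close> is resolved.
\<close>
lemma mass_refined:
  assumes res: "resolved B" and [measurable]: "m' \<in> borel_measurable M"
    and lim: "AE \<omega> in M. (\<lambda>k. refined B k \<omega>) \<longlonglongrightarrow> m' \<omega>"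
  shows "AE \<omega> in M. mass \<omega> = m' \<omega>"
proof -
  have B[measurable]: "B \<in> events" and l: "leak B \<longlonglongrightarrow> 0" using res by (auto simp: resolved_def)
  have l': "leak (space M - B) \<longlonglongrightarrow> 0" using resolved_compl[OF res] by (simp add: resolved_def)
  define D where "D k \<omega> = indicator B \<omega> * outside B k \<omega> + indicator (space M - B) \<omega> * outside (space M - B) k \<omega>" for k \<omega>
  have [measurable]: "D k \<in> borel_measurable M" for k unfolding D_def[abs_def] by measurable
  have cB: "cell k w - (space M - B) = cell k w \<inter> B" for k w by (auto simp: cell_def)
  have D: "AE \<omega> in M. mass_at k \<omega> - refined B k \<omega> = D k \<omega>" for k
  proof -
    have "AE \<omega> in M. \<forall>w. cprob (cell k w) \<omega> = cprob (cell k w \<inter> B) \<omega> + cprob (cell k w - B) \<omega>"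
      unfolding AE_all_countable
    proof
      fix w
      have "cell k w = (cell k w \<inter> B) \<union> (cell k w - B)" by auto
      then show "AE \<omega> in M. cprob (cell k w) \<omega> = cprob (cell k w \<inter> B) \<omega> + cprob (cell k w - B) \<omega>"
        using cprob_union[of "cell k w \<inter> B" "cell k w - B"] by auto
    qed
    moreover note AE_space
    ultimately show ?thesis
      unfolding D_def mass_at_def refined_def outside_def cB by eventually_elim auto
  qed
  have b: "AE \<omega> in M. 0 \<le> D k \<omega> \<and> D k \<omega> \<le> 1" for k
    using AE_outside_bounds[OF B, of k] AE_outside_bounds[OF sets.compl_sets[OF B], of k]
    unfolding D_def by (eventually_elim) (auto split: split_indicator)
  have "(\<lambda>k. \<integral>\<omega>. D k \<omega> \<partial>M) = (\<lambda>k. leak B k + leak (space M - B) k)"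
    unfolding D_def leak_def
    by (intro ext Bochner_Integration.integral_add integrable_leak) auto
  then have "(\<lambda>k. \<integral>\<omega>. D k \<omega> \<partial>M) \<longlonglongrightarrow> 0" using tendsto_add[OF l l'] by simp
  have "AE \<omega> in M. \<forall>k. mass_at k \<omega> - refined B k \<omega> = D k \<omega>" using D by (simp add: AE_all_countable)
  with lim AE_coherent have conv: "AE \<omega> in M. (\<lambda>k. D k \<omega>) \<longlonglongrightarrow> mass \<omega> - m' \<omega>"
  proof eventually_elim
    case (elim \<omega>)
    then have "(\<lambda>k. D k \<omega>) = (\<lambda>k. mass_at k \<omega> - refined B k \<omega>)" by auto
    then show ?case using tendsto_diff[OF mass_at_tendsto[OF elim(2)] elim(1)] by simp
  qed
  have dct: "(\<lambda>k. \<integral>\<omega>. D k \<omega> \<partial>M) \<longlonglongrightarrow> (\<integral>\<omega>. mass \<omega> - m' \<omega> \<partial>M)"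
  proof (rule integral_dominated_convergence[where w = "\<lambda>_. 1", OF _ _ _ conv])
    show "AE \<omega> in M. norm (D k \<omega>) \<le> 1" for k
      using b[of k] by eventually_elim auto
  qed simp_all
  have b': "AE \<omega> in M. \<forall>k. 0 \<le> D k \<omega> \<and> D k \<omega> \<le> 1" using b by (simp add: AE_all_countable)
  with conv have b'': "AE \<omega> in M. 0 \<le> mass \<omega> - m' \<omega> \<and> mass \<omega> - m' \<omega> \<le> 1"
  proof eventually_elim
    case (elim \<omega>)
    then show ?case
      using LIMSEQ_le_const[OF elim(1), of 0] LIMSEQ_le_const2[OF elim(1), of 1] by blast
  qed
  have "(\<integral>\<omega>. mass \<omega> - m' \<omega> \<partial>M) = 0"
    using dct \<open>(\<lambda>k. \<integral>\<omega>. D k \<omega> \<partial>M) \<longlonglongrightarrow> 0\<close> by (rule LIMSEQ_unique)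
  moreover have "integrable M (\<lambda>\<omega>. mass \<omega> - m' \<omega>)"
    by (rule integrable_const_bound[of _ 1]) (use b'' in \<open>auto elim: eventually_mono\<close>)
  ultimately have "AE \<omega> in M. mass \<omega> - m' \<omega> = 0"
    using b'' by (subst (asm) integral_nonneg_eq_0_iff_AE) (auto elim: eventually_mono)
  then show ?thesis by simp
qed

end

section \<open>Random variables whose level sets are trivial\<close>

lemma lim_shift: "lim (\<lambda>j. f (j + N)) = lim (f :: nat \<Rightarrow> real)"
proof -
  have "(\<lambda>j. f (j + N)) \<longlonglongrightarrow> L \<longleftrightarrow> f \<longlonglongrightarrow> L" for L
    using LIMSEQ_ignore_initial_segment LIMSEQ_offset by blast
  then show ?thesis by (simp add: lim_def)
qed

text \<open>
  Of the two alternatives \<open>X \<le> t\<close> almost surely and \<open>X > t\<close> almost surely, the position of \<open>t\<close> relative to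
  the expectation decides.
\<close>
lemma (in prob_space) AE_const_if_0_1:
  assumes X: "integrable M (X :: 'a \<Rightarrow> real)"
    and zo: "\<And>t. prob {\<omega>\<in>space M. X \<omega> \<le> t} = 0 \<or> prob {\<omega>\<in>space M. X \<omega> \<le> t} = 1"
  obtains c where "AE \<omega> in M. X \<omega> = c"
proof -
  have [measurable]: "X \<in> borel_measurable M" using X by simp
  define c where "c = expectation X"
  have iff: "(AE \<omega> in M. X \<omega> \<le> t) \<or> (AE \<omega> in M. t < X \<omega>)" for t
  proof (cases "prob {\<omega>\<in>space M. X \<omega> \<le> t} = 1")
    case True
    then show ?thesis by (subst (asm) prob_Collect_eq_1) auto
  next
    case False
    with zo have "prob {\<omega>\<in>space M. X \<omega> \<le> t} = 0" by blast
    then show ?thesis by (subst (asm) prob_Collect_eq_0) (auto simp: not_le)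
  qed
  have le: "AE \<omega> in M. X \<omega> \<le> t" if "c < t" for t
  proof (rule ccontr)
    assume "\<not> ?thesis"
    with iff have "AE \<omega> in M. t < X \<omega>" by blast
    then have "expectation (\<lambda>_. t) \<le> c"
      unfolding c_def using X by (intro integral_mono_AE) (auto elim: eventually_mono)
    with that show False by (simp add: prob_space)
  qed
  have ge: "AE \<omega> in M. t < X \<omega>" if "t < c" for t
  proof (rule ccontr)
    assume "\<not> ?thesis"
    with iff have "AE \<omega> in M. X \<omega> \<le> t" by blast
    then have "c \<le> expectation (\<lambda>_. t)"
      unfolding c_def using X by (intro integral_mono_AE) (auto elim: eventually_mono)
    with that show False by (simp add: prob_space)
  qed
  have "AE \<omega> in M. \<forall>j. X \<omega> \<le> c + inverse (real (Suc j)) \<and> c - inverse (real (Suc j)) < X \<omega>"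
    unfolding AE_all_countable using le ge by auto
  then have "AE \<omega> in M. X \<omega> = c"
  proof eventually_elim
    case (elim \<omega>)
    show ?case
    proof (rule antisym)
      show "X \<omega> \<le> c" using LIMSEQ_inverse_real_of_nat_add[of c] elim
        by (intro LIMSEQ_le_const) auto
      show "c \<le> X \<omega>" using LIMSEQ_inverse_real_of_nat_add_minus[of c] elim
        by (intro LIMSEQ_le_const2) (auto intro!: exI[of _ 0] less_imp_le)
    qed
  qed
  then show ?thesis by (rule that)
qed

section \<open>The sign transformation of a coin-tossing sequence\<close>

locale coin_transform = prob_space M for M :: "'a measure" +
  fixes \<epsilon> H :: "int \<Rightarrow> 'a \<Rightarrow> int"
    and h :: "int \<Rightarrow> (int \<Rightarrow> int) \<Rightarrow> int"
  assumes coin: "coin_tossing M \<epsilon>"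
    and h: "\<And>n. h n \<in> measurable (PiM {..0} (\<lambda>_. sign_space)) sign_space"
    and H: "\<And>n \<omega>. \<omega> \<in> space M \<Longrightarrow> H n \<omega> = h n (past_at (\<lambda>k. \<epsilon> k \<omega>) (n - 1))"
begin

definition \<eta> :: "int \<Rightarrow> 'a \<Rightarrow> int" where "\<eta> n \<omega> = H n \<omega> * \<epsilon> n \<omega>"

definition events_of :: "(int \<Rightarrow> 'a \<Rightarrow> int) \<Rightarrow> int \<Rightarrow> 'a set set" where
  "events_of X n = {X n -` B \<inter> space M | B. B \<in> sets sign_space}"

text \<open>
  The counterpart of \<open>past_field\<close> without null events. The zero-one law and the independence
  arguments apply to it directly.
\<close>
definition history :: "(int \<Rightarrow> 'a \<Rightarrow> int) \<Rightarrow> int \<Rightarrow> 'a measure" where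
  "history X n = sigma (space M) (\<Union>k\<in>{..n}. events_of X k)"

lemma space_history [simp]: "space (history X n) = space M"
  by (simp add: history_def space_measure_of_conv)

lemma sets_history: "sets (history X n) = sigma_sets (space M) (\<Union>k\<in>{..n}. events_of X k)"
  unfolding history_def by (rule sets_measure_of) (auto simp: events_of_def)

lemma Int_stable_events_of: "Int_stable (events_of X n)"
  unfolding events_of_def by (rule Int_stable_vimages)

lemma history_mono: "m \<le> n \<Longrightarrow> sets (history X m) \<subseteq> sets (history X n)"
  unfolding sets_history by (rule sigma_sets_mono') (auto intro: order_trans)

lemma subalgebra_history_mono: "m \<le> n \<Longrightarrow> subalgebra (history X n) (history X m)"
  by (simp add: subalgebra_def history_mono)

lemma events_of_subset:
  assumes "space J = space M" "X n \<in> measurable J sign_space"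
  shows "events_of X n \<subseteq> sets J"
proof
  fix D assume "D \<in> events_of X n"
  then obtain B where "D = X n -` B \<inter> space M" "B \<in> sets sign_space" unfolding events_of_def by blast
  then show "D \<in> sets J" using measurable_sets[OF assms(2), of B] assms(1) by simp
qed

lemma history_subset:
  assumes "space J = space M" "\<And>k. k \<le> n \<Longrightarrow> X k \<in> measurable J sign_space"
  shows "sets (history X n) \<subseteq> sets J"
proof -
  have "(\<Union>k\<in>{..n}. events_of X k) \<subseteq> sets J"
    using assms by (intro UN_least events_of_subset) auto
  then show ?thesis unfolding sets_history assms(1)[symmetric] by (rule sets.sigma_sets_subset)
qed

lemma measurable_history:
  assumes "X k \<in> measurable M sign_space" "k \<le> n"
  shows "X k \<in> measurable (history X n) sign_space"
proof (rule measurableI)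
  show "X k -` B \<inter> space (history X n) \<in> sets (history X n)" if "B \<in> sets sign_space" for B
    using that assms(2) unfolding sets_history space_history
    by (intro sigma_sets.Basic) (auto simp: events_of_def)
qed (use measurable_space[OF assms(1)] in simp)

lemma \<epsilon>_indep: "indep_vars (\<lambda>_. sign_space) \<epsilon> UNIV"
  using coin by (simp add: coin_tossing_def)

lemma \<epsilon>_measurable [measurable]: "\<epsilon> n \<in> measurable M sign_space"
  using \<epsilon>_indep by (simp add: indep_vars_def2)

lemma \<epsilon>_sign: "\<omega> \<in> space M \<Longrightarrow> \<epsilon> n \<omega> \<in> {-1, 1}"
  using measurable_space[OF \<epsilon>_measurable] by simp

lemma H_measurable:
  assumes sp: "space J = space M" and \<epsilon>: "\<And>k. k \<le> n - 1 \<Longrightarrow> \<epsilon> k \<in> measurable J sign_space"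
  shows "H n \<in> measurable J sign_space"
proof -
  have "(\<lambda>\<omega>. past_at (\<lambda>k. \<epsilon> k \<omega>) (n - 1)) \<in> measurable J (PiM {..0} (\<lambda>_. sign_space))"
    unfolding past_at_def by (rule measurable_restrict) (use \<epsilon> in auto)
  from measurable_compose[OF this h] show ?thesis
    by (rule measurable_cong[THEN iffD1, rotated]) (simp add: H sp)
qed

lemma times_sign_measurable:
  assumes "f \<in> measurable J sign_space" "g \<in> measurable J sign_space"
  shows "(\<lambda>\<omega>. f \<omega> * g \<omega>) \<in> measurable J sign_space"
proof -
  have "(\<lambda>\<omega>. (f \<omega>, g \<omega>)) \<in> measurable J (sign_space \<Otimes>\<^sub>M sign_space)" using assms by measurable
  moreover have "(\<lambda>(x, y). x * y) \<in> measurable (sign_space \<Otimes>\<^sub>M sign_space) sign_space"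
    by (subst pair_measure_countable) (auto intro: countable_finite)
  ultimately show ?thesis by (auto dest: measurable_compose simp: case_prod_beta)
qed

lemma H_measurable_past: "H n \<in> measurable (history \<epsilon> (n - 1)) sign_space"
  by (rule H_measurable) (auto intro: measurable_history)

lemma \<eta>_measurable_past: "k \<le> n \<Longrightarrow> \<eta> k \<in> measurable (history \<epsilon> n) sign_space"
  unfolding \<eta>_def[abs_def]
  by (intro times_sign_measurable H_measurable measurable_history) auto

lemma subalgebra_history_\<epsilon>: "subalgebra M (history \<epsilon> n)"
  unfolding subalgebra_def using history_subset[of M n \<epsilon>] by simp

lemma \<eta>_measurable [measurable]: "\<eta> n \<in> measurable M sign_space"
  using measurable_from_subalg[OF subalgebra_history_\<epsilon> \<eta>_measurable_past] by blast

lemma H_measurable_M [measurable]: "H n \<in> measurable M sign_space"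
  using H_measurable[of M] by simp

lemma subalgebra_history_\<eta>: "subalgebra M (history \<eta> n)"
  unfolding subalgebra_def using history_subset[of M n \<eta>] by simp

lemma history_\<eta>_subset: "subalgebra (history \<epsilon> n) (history \<eta> n)"
  unfolding subalgebra_def using history_subset[of "history \<epsilon> n" n \<eta>] \<eta>_measurable_past by simp

lemma prob_\<epsilon>:
  assumes "e \<in> {-1, 1}"
  shows "prob (\<epsilon> n -` {e} \<inter> space M) = 1 / 2"
proof -
  have "prob (\<epsilon> n -` {e} \<inter> space M) = measure (distr M sign_space (\<epsilon> n)) {e}"
    using assms by (subst measure_distr) auto
  also have "\<dots> = measure (uniform_count_measure {-1, 1 :: int}) {e}"
    using coin by (simp add: coin_tossing_def)
  also have "\<dots> = 1 / 2"
    using assms by (subst measure_uniform_count_measure) auto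
  finally show ?thesis .
qed

lemma past_indep_\<epsilon>:
  assumes B: "B \<in> sets (history \<epsilon> (n - 1))" and e: "e \<in> {-1, 1}"
  shows "prob (B \<inter> (\<epsilon> n -` {e} \<inter> space M)) = prob B / 2"
proof -
  define I where "I = case_bool {..n - 1} {n}"
  have "indep_sets (events_of \<epsilon>) (\<Union>j\<in>UNIV. I j)"
    using \<epsilon>_indep indep_sets_mono_index[of _ UNIV] by (simp add: indep_vars_def2 events_of_def[abs_def])
  then have "indep_sets (\<lambda>j. sigma_sets (space M) (\<Union>i\<in>I j. events_of \<epsilon> i)) UNIV"
    by (rule indep_sets_collect_sigma)
      (auto simp: Int_stable_events_of disjoint_family_on_def I_def split: bool.split)
  then have "indep_set (sets (history \<epsilon> (n - 1))) (sigma_sets (space M) (events_of \<epsilon> n))"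
    unfolding indep_set_def sets_history
    by (rule indep_sets_cong[THEN iffD1, rotated -1]) (auto simp: I_def split: bool.split)
  moreover have "\<epsilon> n -` {e} \<inter> space M \<in> sigma_sets (space M) (events_of \<epsilon> n)"
    using e by (intro sigma_sets.Basic) (auto simp: events_of_def intro!: exI[of _ "{e}"])
  ultimately show ?thesis using B prob_\<epsilon>[OF e, of n] by (simp add: indep_setD)
qed

text \<open>
  Split according to the sign \<open>H n\<close>, which is known at time \<open>n - 1\<close>: on each part \<open>\<eta> n = e\<close> prescribes
  the value of the fresh coin \<open>\<epsilon> n\<close>.
\<close>
lemma past_indep_\<eta>_point:
  assumes B: "B \<in> sets (history \<epsilon> (n - 1))" and e: "e \<in> {-1, 1}"
  shows "prob (B \<inter> (\<eta> n -` {e} \<inter> space M)) = prob B / 2"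
proof -
  have sB: "B \<subseteq> space M" using sets.sets_into_space[OF B] by simp
  have Bs: "B \<inter> (H n -` {s} \<inter> space M) \<in> sets (history \<epsilon> (n - 1))" if "s \<in> {-1, 1}" for s
    using B measurable_sets[OF H_measurable_past, of "{s}" n] that by auto
  note ev = subsetD[OF subalgebra_history_\<epsilon>[unfolded subalgebra_def, THEN conjunct2]]
  have Hs: "H n \<omega> \<in> {-1, 1}" if "\<omega> \<in> space M" for \<omega>
    using measurable_space[OF H_measurable_M that] by simp
  define V where "V s = B \<inter> (H n -` {s} \<inter> space M)" for s
  define W where "W s = \<epsilon> n -` {e * s} \<inter> space M" for s
  have es: "e * s \<in> {-1, 1}" if "s \<in> {-1, 1}" for s using e that by auto
  have [measurable]: "V 1 \<in> events" "V (-1) \<in> events" unfolding V_def using Bs ev by auto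
  have [measurable]: "W 1 \<in> events" "W (-1) \<in> events"
    unfolding W_def using es[of 1] es[of "-1"] by (auto intro!: measurable_sets[OF \<epsilon>_measurable])
  have eq: "B \<inter> (\<eta> n -` {e} \<inter> space M) = (V 1 \<inter> W 1) \<union> (V (-1) \<inter> W (-1))"
  proof (intro set_eqI)
    fix \<omega>
    show "\<omega> \<in> B \<inter> (\<eta> n -` {e} \<inter> space M) \<longleftrightarrow> \<omega> \<in> (V 1 \<inter> W 1) \<union> (V (-1) \<inter> W (-1))"
      using Hs[of \<omega>] \<epsilon>_sign[of \<omega> n] by (auto simp: V_def W_def \<eta>_def)
  qed
  have "B = V 1 \<union> V (-1)" using Hs sB by (auto simp: V_def)
  moreover have "V 1 \<inter> V (-1) = {}" by (auto simp: V_def)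
  ultimately have B_sum: "prob B = prob (V 1) + prob (V (-1))"
    by (metis finite_measure_Union \<open>V 1 \<in> events\<close> \<open>V (-1) \<in> events\<close>)
  have "prob (V s \<inter> W s) = prob (V s) / 2" if "s \<in> {-1, 1}" for s
    using past_indep_\<epsilon>[OF Bs[OF that] es[OF that]] by (simp add: V_def W_def)
  from this[of 1] this[of "-1"] have "prob (V 1 \<inter> W 1) + prob (V (-1) \<inter> W (-1)) = prob B / 2"
    unfolding B_sum by simp
  moreover have "prob (B \<inter> (\<eta> n -` {e} \<inter> space M)) = prob (V 1 \<inter> W 1) + prob (V (-1) \<inter> W (-1))"
  proof -
    have "(V 1 \<inter> W 1) \<inter> (V (-1) \<inter> W (-1)) = {}" by (auto simp: V_def)
    then show ?thesis unfolding eq by (intro finite_measure_Union) simp_all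
  qed
  ultimately show ?thesis by simp
qed

lemma past_indep_\<eta>:
  assumes B: "B \<in> sets (history \<epsilon> (n - 1))" and D: "D \<in> events_of \<eta> n"
  shows "prob (B \<inter> D) = prob B * prob D"
proof -
  have sB: "B \<subseteq> space M" using sets.sets_into_space[OF B] by simp
  have sM: "space M \<in> sets (history \<epsilon> (n - 1))" using sets.top[of "history \<epsilon> (n - 1)"] by simp
  obtain S where S: "D = \<eta> n -` S \<inter> space M" "S \<subseteq> {-1, 1}" using D by (auto simp: events_of_def)
  have point: "prob (B \<inter> (\<eta> n -` {e} \<inter> space M)) = prob B * prob (\<eta> n -` {e} \<inter> space M)" if "e \<in> {-1, 1}" for e
  proof -
    have "space M \<inter> (\<eta> n -` {e} \<inter> space M) = \<eta> n -` {e} \<inter> space M" by auto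
    then have half: "prob (\<eta> n -` {e} \<inter> space M) = 1 / 2"
      using past_indep_\<eta>_point[OF sM that] by (simp add: prob_space)
    show ?thesis unfolding half past_indep_\<eta>_point[OF B that] by simp
  qed
  have all: "\<eta> n -` {-1, 1} \<inter> space M = space M"
    using measurable_space[OF \<eta>_measurable] by auto
  have "S = {} \<or> S = {-1} \<or> S = {1} \<or> S = {-1, 1}" using S(2) by blast
  then show ?thesis
    using point[of 1] point[of "-1"] all sB by (auto simp: S(1) Int_absorb2 prob_space)
qed

text \<open>
  Passing from time \<open>n - 1\<close> to time \<open>n\<close> adjoins the single coin \<open>\<eta> n\<close>; the intersections form a \<open>\<pi>\<close>-system.
\<close>
lemma history_\<eta>_step:
  "sets (history \<eta> n) = sigma_sets (space M) {C \<inter> D | C D. C \<in> sets (history \<eta> (n - 1)) \<and> D \<in> events_of \<eta> n}"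
    (is "_ = sigma_sets _ ?gen")
proof (rule antisym)
  have top: "space M \<in> sets (history \<eta> (n - 1))" using sets.top[of "history \<eta> (n - 1)"] by simp
  have top': "space M \<in> events_of \<eta> n"
    using measurable_space[OF \<eta>_measurable] by (auto simp: events_of_def intro!: exI[of _ "{-1, 1}"])
  have "events_of \<eta> k \<subseteq> ?gen" if "k \<le> n" for k
  proof (cases "k = n")
    case True
    show ?thesis
    proof
      fix D assume D: "D \<in> events_of \<eta> k"
      then have "D = space M \<inter> D" by (auto simp: events_of_def)
      then show "D \<in> ?gen" using top D True by blast
    qed
  next
    case False
    show ?thesis
    proof
      fix C assume C: "C \<in> events_of \<eta> k"
      then have "C \<in> sets (history \<eta> (n - 1))"
        using False that unfolding sets_history by (intro sigma_sets.Basic) auto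
      moreover have "C = C \<inter> space M" using C by (auto simp: events_of_def)
      ultimately show "C \<in> ?gen" using top' by blast
    qed
  qed
  then show "sets (history \<eta> n) \<subseteq> sigma_sets (space M) ?gen"
    unfolding sets_history by (intro sigma_sets_mono') auto
  have "?gen \<subseteq> sets (history \<eta> n)"
  proof safe
    fix C D assume "C \<in> sets (history \<eta> (n - 1))" and D: "D \<in> events_of \<eta> n"
    then have "C \<in> sets (history \<eta> n)" using history_mono[of "n - 1" n \<eta>] by auto
    moreover have "D \<in> sets (history \<eta> n)"
      using D unfolding sets_history by (intro sigma_sets.Basic) auto
    ultimately show "C \<inter> D \<in> sets (history \<eta> n)" by blast
  qed
  from sets.sigma_sets_subset[OF this] show "sigma_sets (space M) ?gen \<subseteq> sets (history \<eta> n)" by simp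
qed

text \<open>
  The past of \<open>\<epsilon>\<close> at time \<open>n\<close>, read backwards from time \<open>n\<close>, as a sequence of bits.
\<close>
definition past_bit :: "int \<Rightarrow> nat \<Rightarrow> 'a \<Rightarrow> nat" where
  "past_bit n i \<omega> = (if \<epsilon> (n - int i) \<omega> = 1 then 1 else 0)"

lemma past_bit_measurable:
  assumes "\<And>k. k \<le> n \<Longrightarrow> \<epsilon> k \<in> measurable J sign_space"
  shows "past_bit n i \<in> measurable J (count_space UNIV)"
proof -
  have "(\<lambda>x. if x = 1 then 1 else 0) \<in> measurable sign_space (count_space (UNIV :: nat set))" by simp
  from measurable_compose[OF assms[of "n - int i"] this] show ?thesis
    unfolding past_bit_def[abs_def] by simp
qed

lemma refining_words_past_bit: "refining_words M (history \<eta> m) (past_bit n)"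
  by unfold_locales (auto intro!: subalgebra_history_\<eta> past_bit_measurable simp: past_bit_def)

lemma word_cons: "word (past_bit n) (Suc k) \<omega> = 2 ^ k * past_bit n 0 \<omega> + word (past_bit (n - 1)) k \<omega>"
proof (induction k)
  case (Suc k)
  have "past_bit n (Suc k) \<omega> = past_bit (n - 1) k \<omega>" by (simp add: past_bit_def algebra_simps)
  then show ?case using Suc by simp
qed simp

lemma \<epsilon>_measurable_if_cells:
  assumes sp: "space J = space M" and cells: "\<And>k w. {\<omega>\<in>space M. word (past_bit n) k \<omega> = w} \<in> sets J" and k: "k \<le> n"
  shows "\<epsilon> k \<in> measurable J sign_space"
proof -
  define i where "i = nat (n - k)"
  have "word (past_bit n) (Suc i) \<in> measurable J (count_space UNIV)"
  proof (subst measurable_count_space_eq2_countable, simp_all, intro allI)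
    fix w
    have "word (past_bit n) (Suc i) -` {w} \<inter> space J = {\<omega>\<in>space M. word (past_bit n) (Suc i) \<omega> = w}" using sp by auto
    with cells[of "Suc i" w] show "word (past_bit n) (Suc i) -` {w} \<inter> space J \<in> sets J" by simp
  qed
  moreover have "(\<lambda>w. if odd w then 1 else - 1) \<in> measurable (count_space (UNIV :: nat set)) sign_space" by auto
  ultimately have m: "(\<lambda>\<omega>. if odd (word (past_bit n) (Suc i) \<omega>) then 1 else - 1) \<in> measurable J sign_space"
    by (rule measurable_compose)
  have "(if odd (word (past_bit n) (Suc i) \<omega>) then 1 else - 1) = \<epsilon> k \<omega>" if "\<omega> \<in> space J" for \<omega>
    using \<epsilon>_sign[of \<omega> k] that k by (auto simp: past_bit_def i_def sp)
  from measurable_cong[THEN iffD1, OF this m] show ?thesis .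
qed

section \<open>The atom mass is a deterministic constant\<close>

text \<open>
  The conditional probability, given the history of \<open>\<eta>\<close> at time \<open>n\<close>, of the past of \<open>\<epsilon>\<close> that occurs.
\<close>
definition atom_mass :: "int \<Rightarrow> 'a \<Rightarrow> real" where
  "atom_mass n = refining_words.mass M (history \<eta> n) (past_bit n)"

lemma atom_mass_measurable: "atom_mass n \<in> borel_measurable (history \<epsilon> n)"
  unfolding atom_mass_def
  by (rule refining_words.mass_measurable[OF refining_words_past_bit])
    (auto intro!: history_\<eta>_subset past_bit_measurable measurable_history)

lemma atom_mass_measurable_M [measurable]: "atom_mass n \<in> borel_measurable M"
  using measurable_from_subalg[OF subalgebra_history_\<epsilon> atom_mass_measurable] .

text \<open>
  Two changes lead from time \<open>n - 1\<close> to time \<open>n\<close>. Conditioning on the additional coin \<open>\<eta> n\<close> changes nothing,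
  since it is independent of the past of \<open>\<epsilon>\<close> up to time \<open>n - 1\<close>. Recording the additional bit \<open>\<epsilon> n\<close> changes nothing
  in the limit either, since \<open>\<epsilon> n = H n * \<eta> n\<close> is a function of that past and of \<open>\<eta> n\<close>. At a finite
  stage it does matter, because \<open>H n\<close> may depend on infinitely many bits; therefore
  \<open>mass_refined\<close> is applied, and not a bijection between cells.
\<close>
lemma atom_mass_step: "AE \<omega> in M. atom_mass (n - 1) \<omega> = atom_mass n \<omega>"
proof -
  \<comment> \<open>From \<open>Q\<close> to \<open>P\<close> the conditioning field grows, from \<open>P\<close> to \<open>N\<close> the bits are shifted by one.\<close>
  interpret Q: refining_words M "history \<eta> (n - 1)" "past_bit (n - 1)" by (rule refining_words_past_bit)
  interpret P: refining_words M "history \<eta> n" "past_bit (n - 1)" by (rule refining_words_past_bit)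
  interpret N: refining_words M "history \<eta> n" "past_bit n" by (rule refining_words_past_bit)
  have cell_past: "P.cell k w \<in> sets (history \<epsilon> (n - 1))" for k w
  proof -
    have [measurable]: "word (past_bit (n - 1)) k \<in> measurable (history \<epsilon> (n - 1)) (count_space UNIV)"
      by (intro word_measurable past_bit_measurable measurable_history) auto
    have "{\<omega>\<in>space (history \<epsilon> (n - 1)). word (past_bit (n - 1)) k \<omega> = w} \<in> sets (history \<epsilon> (n - 1))" by measurable
    then show ?thesis by (simp add: P.cell_def)
  qed
  have "AE \<omega> in M. \<forall>k w. P.cprob (P.cell k w) \<omega> = Q.cprob (P.cell k w) \<omega>"
    unfolding AE_all_countable
  proof (intro allI Q.cprob_adjoin_independent[OF _ history_\<eta>_step _ _ _ subalgebra_history_\<epsilon>])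
    show "events_of \<eta> n \<subseteq> events" by (intro events_of_subset) auto
  qed (use P.conditioning_axioms cell_past past_indep_\<eta> in \<open>auto intro!: subalgebra_history_mono Int_stable_events_of history_\<eta>_subset\<close>)
  then have QP: "AE \<omega> in M. Q.mass \<omega> = P.mass \<omega>"
    by eventually_elim (simp add: Q.mass_def P.mass_def Q.mass_at_def P.mass_at_def)
  define B where "B = {\<omega>\<in>space M. \<epsilon> n \<omega> = 1}"
  have "P.resolved B"
  proof (rule P.resolved_sigma)
    let ?gen = "sets (history \<eta> n) \<union> {P.cell k w | k w. True}"
    define J where "J = sigma (space M) ?gen"
    have sub: "?gen \<subseteq> Pow (space M)"
      using sets.sets_into_space[of _ "history \<eta> n"] by (auto simp: P.cell_def)
    have spJ: "space J = space M" by (simp add: J_def space_measure_of_conv)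
    have J: "sets J = sigma_sets (space M) ?gen" unfolding J_def using sub by (rule sets_measure_of)
    have \<epsilon>J: "\<epsilon> k \<in> measurable J sign_space" if "k \<le> n - 1" for k
      using that by (intro \<epsilon>_measurable_if_cells[where n = "n - 1"] spJ)
        (auto simp: J P.cell_def intro!: sigma_sets.Basic)
    have "subalgebra J (history \<eta> n)" using spJ J by (auto simp: subalgebra_def intro: sigma_sets.Basic)
    then have \<eta>J: "\<eta> n \<in> measurable J sign_space"
      by (rule measurable_from_subalg) (intro measurable_history; simp)
    have "(\<lambda>\<omega>. H n \<omega> * \<eta> n \<omega>) \<in> measurable J sign_space"
      using \<epsilon>J \<eta>J by (intro times_sign_measurable H_measurable spJ)
    moreover have "H n \<omega> * \<eta> n \<omega> = \<epsilon> n \<omega>" if "\<omega> \<in> space J" for \<omega>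
      using measurable_space[OF H_measurable_M, of \<omega> n] that by (auto simp: \<eta>_def spJ)
    ultimately have "\<epsilon> n \<in> measurable J sign_space" by (simp cong: measurable_cong)
    from measurable_sets[OF this, of "{1}"] have "\<epsilon> n -` {1} \<inter> space J \<in> sets J" by simp
    moreover have "\<epsilon> n -` {1} \<inter> space J = B" by (auto simp: B_def spJ)
    ultimately show "B \<in> sigma_sets (space M) ?gen" by (simp add: J)
  qed
  moreover have "AE \<omega> in M. (\<lambda>k. P.refined B k \<omega>) \<longlonglongrightarrow> N.mass \<omega>"
    using N.AE_coherent
  proof eventually_elim
    case (elim \<omega>)
    then have \<omega>: "\<omega> \<in> space M" by (rule N.coherent_space)
    have "P.refined B k \<omega> = N.mass_at (Suc k) \<omega>" for k
    proof -
      let ?w = "word (past_bit (n - 1)) k"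
      \<comment> \<open>The additional bit is the leading one of the longer word, so that it decides on which side of \<open>B\<close> the point lies.\<close>
      have "word (past_bit n) (Suc k) \<omega>' = word (past_bit n) (Suc k) \<omega> \<longleftrightarrow> ?w \<omega>' = ?w \<omega> \<and> (\<omega>' \<in> B \<longleftrightarrow> \<omega> \<in> B)"
        if "\<omega>' \<in> space M" for \<omega>'
        unfolding word_cons using P.word_less[OF that, of k] P.word_less[OF \<omega>, of k] that \<omega>
        by (auto simp: past_bit_def B_def)
      then have "N.cell (Suc k) (word (past_bit n) (Suc k) \<omega>) =
          (if \<omega> \<in> B then P.cell k (?w \<omega>) \<inter> B else P.cell k (?w \<omega>) - B)"
        by (auto simp: N.cell_def P.cell_def simp del: word.simps)
      then show ?thesis by (simp add: P.refined_def N.mass_at_def del: word.simps)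
    qed
    then show ?case using LIMSEQ_Suc[OF N.mass_at_tendsto[OF elim]] by simp
  qed
  ultimately have "AE \<omega> in M. P.mass \<omega> = N.mass \<omega>"
    by (intro P.mass_refined) auto
  with QP show ?thesis unfolding atom_mass_def by eventually_elim simp
qed

lemma atom_mass_eq: "AE \<omega> in M. atom_mass m \<omega> = atom_mass n \<omega>"
proof -
  have up: "AE \<omega> in M. atom_mass i \<omega> = atom_mass j \<omega>" if "i \<le> j" for i j
    using that
  proof (induction rule: int_ge_induct)
    case (step k)
    with atom_mass_step[of "k + 1"] show ?case by (auto elim: eventually_elim2)
  qed simp
  show ?thesis
    using up[of m n] up[of n m] by (cases "m \<le> n") (auto elim: eventually_mono)
qed

lemma atom_mass_constant:
  obtains p where "\<And>n. AE \<omega> in M. atom_mass n \<omega> = p"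
proof -
  \<comment> \<open>A single version that is measurable with respect to the history at every time: the limit is
    unaffected by dropping finitely many terms.\<close>
  define X where "X \<omega> = lim (\<lambda>j. atom_mass (- int j) \<omega>)" for \<omega>
  have X_meas: "X \<in> borel_measurable (history \<epsilon> (- int N))" for N
  proof -
    have "X = (\<lambda>\<omega>. lim (\<lambda>j. atom_mass (- int (j + N)) \<omega>))"
      unfolding X_def lim_shift[of "\<lambda>j. atom_mass (- int j) _"] ..
    also have "\<dots> \<in> borel_measurable (history \<epsilon> (- int N))"
      by (intro borel_measurable_lim_metric measurable_from_subalg[OF subalgebra_history_mono atom_mass_measurable]) simp
    finally show ?thesis .
  qed
  have X_M[measurable]: "X \<in> borel_measurable M"
    using measurable_from_subalg[OF subalgebra_history_\<epsilon> X_meas] .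
  have X_eq: "AE \<omega> in M. X \<omega> = atom_mass n \<omega>" for n
  proof -
    have "AE \<omega> in M. \<forall>j. atom_mass (- int j) \<omega> = atom_mass n \<omega>"
      unfolding AE_all_countable using atom_mass_eq by blast
    then show ?thesis by eventually_elim (simp add: X_def)
  qed
  define A where "A j = sigma_sets (space M) (events_of \<epsilon> (- int j))" for j
  have "indep_sets (events_of \<epsilon>) (\<Union>j\<in>UNIV. {- int j})"
    using \<epsilon>_indep indep_sets_mono_index[of _ UNIV] by (simp add: indep_vars_def2 events_of_def[abs_def])
  then have "indep_sets (\<lambda>j. sigma_sets (space M) (\<Union>i\<in>{- int j}. events_of \<epsilon> i)) UNIV"
    by (rule indep_sets_collect_sigma) (auto simp: Int_stable_events_of disjoint_family_on_def)
  then have indep: "indep_sets A UNIV" by (simp add: A_def[abs_def])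
  have sa: "sigma_algebra (space M) (A j)" for j
    unfolding A_def by (rule sigma_algebra_sigma_sets) (auto simp: events_of_def)
  have "{\<omega>\<in>space M. X \<omega> \<le> t} \<in> tail_events A" for t
    unfolding tail_events_def
  proof safe
    fix N :: nat
    have "{\<omega>\<in>space (history \<epsilon> (- int N)). X \<omega> \<le> t} \<in> sets (history \<epsilon> (- int N))"
      using X_meas[of N] by measurable
    moreover have "events_of \<epsilon> k \<subseteq> \<Union> (A ` {N..})" if "k \<le> - int N" for k
      using that by (auto simp: A_def intro!: bexI[of _ "nat (- k)"])
    then have "sets (history \<epsilon> (- int N)) \<subseteq> sigma_sets (space M) (\<Union> (A ` {N..}))"
      unfolding sets_history by (intro sigma_sets_mono') auto
    ultimately show "{\<omega>\<in>space M. X \<omega> \<le> t} \<in> sigma_sets (space M) (\<Union> (A ` {N..}))" by auto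
  qed
  then have "prob {\<omega>\<in>space M. X \<omega> \<le> t} = 0 \<or> prob {\<omega>\<in>space M. X \<omega> \<le> t} = 1" for t
    by (rule kolmogorov_0_1_law[OF sa indep])
  moreover have "integrable M X"
  proof (rule integrable_const_bound[of _ 1])
    interpret N: refining_words M "history \<eta> 0" "past_bit 0" by (rule refining_words_past_bit)
    show "AE \<omega> in M. norm (X \<omega>) \<le> 1"
      using N.AE_coherent X_eq[of 0]
      by eventually_elim (auto simp: atom_mass_def N.mass_bounds)
  qed simp
  ultimately obtain c where c: "AE \<omega> in M. X \<omega> = c" using AE_const_if_0_1 by blast
  have "AE \<omega> in M. atom_mass n \<omega> = c" for n
    using c X_eq[of n] by eventually_elim simp
  then show ?thesis by (rule that)
qed

section \<open>The complement\<close>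

definition rank_var :: "int \<Rightarrow> 'a \<Rightarrow> real" where
  "rank_var n = refining_words.rank M (history \<eta> n) (past_bit n)"

lemma rank_var_measurable: "rank_var n \<in> borel_measurable (history \<epsilon> n)"
  unfolding rank_var_def
  by (rule refining_words.rank_measurable[OF refining_words_past_bit])
    (auto intro!: history_\<eta>_subset past_bit_measurable measurable_history)

lemma rank_var_measurable_M [measurable]: "rank_var n \<in> borel_measurable M"
  using measurable_from_subalg[OF subalgebra_history_\<epsilon> rank_var_measurable] .

text \<open>
  At time \<open>n\<close> this is the independence of the rank from the conditioning field. Each later coin \<open>\<eta> (m + 1)\<close>
  is independent of the history of \<open>\<epsilon>\<close> at time \<open>m\<close>, which contains both the rank and the
  history of \<open>\<eta>\<close>.
\<close>
lemma rank_var_indep_history: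
  assumes p: "AE \<omega> in M. atom_mass n \<omega> = p" and "n \<le> m"
    and S: "S \<in> sets borel" and "b \<in> sets (history \<eta> m)"
  shows "prob (rank_var n -` S \<inter> space M \<inter> b) = prob (rank_var n -` S \<inter> space M) * prob b"
  using assms(2,4)
proof (induction arbitrary: b rule: int_ge_induct)
  case base
  interpret N: refining_words M "history \<eta> n" "past_bit n" by (rule refining_words_past_bit)
  show ?case
    using N.rank_indep[OF p[unfolded atom_mass_def] base S] by (simp add: rank_var_def Int_commute mult.commute)
next
  case (step m)
  let ?a = "rank_var n -` S \<inter> space M"
  let ?gen = "{C \<inter> D | C D. C \<in> sets (history \<eta> m) \<and> D \<in> events_of \<eta> (m + 1)}"
  have a: "?a \<in> sets (history \<epsilon> m)"
    using measurable_sets[OF rank_var_measurable S, of n] history_mono[OF step.hyps(1), of \<epsilon>] by auto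
  have aM: "?a \<in> events" using S by measurable
  have \<eta>\<epsilon>: "sets (history \<eta> m) \<subseteq> sets (history \<epsilon> m)"
    using history_\<eta>_subset by (simp add: subalgebra_def)
  have genM: "?gen \<subseteq> events"
    using subalgebra_history_\<eta>[of m] events_of_subset[of M \<eta> "m + 1"] by (auto simp: subalgebra_def)
  have "indep_set {?a} ?gen"
  proof (rule indep_setI)
    fix a b assume "a \<in> {?a}" "b \<in> ?gen"
    then obtain C D where *: "a = ?a" "b = C \<inter> D" "C \<in> sets (history \<eta> m)" "D \<in> events_of \<eta> (m + 1)" by blast
    have "?a \<inter> C \<in> sets (history \<epsilon> m)" using a *(3) \<eta>\<epsilon> by blast
    then have "prob (?a \<inter> C \<inter> D) = prob (?a \<inter> C) * prob D"
      using past_indep_\<eta>[of "?a \<inter> C" "m + 1" D] *(4) by simp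
    also have "\<dots> = prob ?a * (prob C * prob D)" using step.IH[OF *(3)] by simp
    also have "prob C * prob D = prob (C \<inter> D)"
      using past_indep_\<eta>[of C "m + 1" D] *(3,4) \<eta>\<epsilon> by auto
    finally show "prob (a \<inter> b) = prob a * prob b" by (simp add: * Int_assoc)
  qed (use aM genM in auto)
  moreover have "Int_stable ?gen"
    by (intro Int_stable_pairs Int_stable_events_of) (auto simp: Int_stable_def)
  ultimately have "indep_set (sigma_sets (space M) {?a}) (sigma_sets (space M) ?gen)"
    by (intro indep_set_sigma_sets) (auto simp: Int_stable_def)
  moreover have "b \<in> sigma_sets (space M) ?gen"
    using step.prems history_\<eta>_step[of "m + 1"] by simp
  ultimately show ?case by (auto intro: indep_setD sigma_sets.Basic)
qed

text \<open>
  The field \<open>J\<close> stands for either of the two joins: each of them contains the null events and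
  makes the rank and the history of \<open>\<eta>\<close> at time \<open>n\<close> measurable.
\<close>
lemma \<epsilon>_measurable_from_rank:
  assumes p: "AE \<omega> in M. atom_mass n \<omega> = p"
    and sp: "space J = space M" and null: "null_sets M \<subseteq> sets J"
    and \<eta>J: "\<And>k. k \<le> n \<Longrightarrow> \<eta> k \<in> measurable J sign_space" and UJ: "rank_var n \<in> borel_measurable J"
    and "k \<le> n"
  shows "\<epsilon> k \<in> measurable J sign_space"
proof (rule \<epsilon>_measurable_if_cells[OF sp _ \<open>k \<le> n\<close>])
  interpret N: refining_words M "history \<eta> n" "past_bit n" by (rule refining_words_past_bit)
  have sub: "subalgebra J (history \<eta> n)"
    using history_subset[OF sp \<eta>J] by (simp add: subalgebra_def sp)
  fix k w
  show "{\<omega>\<in>space M. word (past_bit n) k \<omega> = w} \<in> sets J"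
  proof (cases "w < 2 ^ k")
    case False
    then have "{\<omega>\<in>space M. word (past_bit n) k \<omega> = w} = {}" using N.word_less by auto
    then show ?thesis by (metis sets.empty_sets)
  next
    case True
    have [measurable]: "N.low k v \<in> borel_measurable J" for v
      using measurable_from_subalg[OF sub N.low_measurable(1)] .
    define V where "V = {\<omega>\<in>space M. N.low k w \<omega> \<le> rank_var n \<omega> \<and> rank_var n \<omega> < N.low k (Suc w) \<omega>}"
    have "{\<omega>\<in>space J. N.low k w \<omega> \<le> rank_var n \<omega> \<and> rank_var n \<omega> < N.low k (Suc w) \<omega>} \<in> sets J"
      using UJ by measurable
    then have VJ: "V \<in> sets J" by (simp add: V_def sp)
    have VM[measurable]: "V \<in> events" unfolding V_def by measurable
    have ae: "AE \<omega> in M. \<omega> \<in> N.cell k w \<longleftrightarrow> \<omega> \<in> V"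
      using N.AE_word_iff_rank[OF p[unfolded atom_mass_def]] AE_space
      by eventually_elim (use True in \<open>auto simp: V_def N.cell_def rank_var_def\<close>)
    have "N.cell k w - V \<in> null_sets M" "V - N.cell k w \<in> null_sets M"
      using ae by (auto simp: AE_iff_null_sets elim: eventually_mono)
    then have "(V - (V - N.cell k w)) \<union> (N.cell k w - V) \<in> sets J"
      using VJ null by blast
    moreover have "(V - (V - N.cell k w)) \<union> (N.cell k w - V) = {\<omega>\<in>space M. word (past_bit n) k \<omega> = w}"
      by (auto simp: N.cell_def V_def)
    ultimately show ?thesis by simp
  qed
qed

lemma subalgebra_past_history: "subalgebra (past_field M \<epsilon> n) (history \<epsilon> n)"
proof -
  have sp: "space (past_field M \<epsilon> n) = space M" by (intro space_past_field \<epsilon>_measurable)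
  have "sets (history \<epsilon> n) \<subseteq> sets (past_field M \<epsilon> n)"
  proof (rule history_subset[OF sp])
    show "\<epsilon> k \<in> measurable (past_field M \<epsilon> n) sign_space" if "k \<le> n" for k
      using that by (intro measurable_past_field[of \<epsilon>] \<epsilon>_measurable)
  qed
  then show ?thesis unfolding subalgebra_def space_history by (intro conjI sp[symmetric])
qed

lemma rank_var_past_measurable: "rank_var n \<in> borel_measurable (past_field M \<epsilon> n)"
  using measurable_from_subalg[OF subalgebra_past_history rank_var_measurable] .

lemma \<eta>_past_measurable: "k \<le> n \<Longrightarrow> \<eta> k \<in> measurable (past_field M \<epsilon> n) sign_space"
  using measurable_from_subalg[OF subalgebra_past_history \<eta>_measurable_past] .

lemmas \<epsilon>_fields = space_past_field[of \<epsilon>, OF \<epsilon>_measurable] null_sets_past_field[of \<epsilon>, OF \<epsilon>_measurable]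
  space_full_field[of \<epsilon>, OF \<epsilon>_measurable] null_sets_full_field[of \<epsilon>, OF \<epsilon>_measurable]

lemmas \<eta>_fields = space_past_field[of \<eta>, OF \<eta>_measurable] null_sets_past_field[of \<eta>, OF \<eta>_measurable]
  space_full_field[of \<eta>, OF \<eta>_measurable] null_sets_full_field[of \<eta>, OF \<eta>_measurable]

lemma join_past_rank_var:
  assumes p: "AE \<omega> in M. atom_mass n \<omega> = p"
  shows "sets (join_field (past_field M \<eta> n) (var_field M (rank_var n))) = sets (past_field M \<epsilon> n)"
proof (rule antisym)
  let ?V = "var_field M (rank_var n)"
  let ?J = "join_field (past_field M \<eta> n) ?V"
  note sp = \<epsilon>_fields(1) \<eta>_fields(1) space_var_field[OF rank_var_measurable_M]
  have J: "space ?J = space M" "subalgebra ?J (past_field M \<eta> n)" "subalgebra ?J ?V"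
    using join_field[of "past_field M \<eta> n" ?V] by (auto simp: subalgebra_def sp)
  show "sets ?J \<subseteq> sets (past_field M \<epsilon> n)"
    by (intro join_field past_field_subset var_field_subset \<epsilon>_fields rank_var_past_measurable
        \<eta>_past_measurable \<eta>_measurable rank_var_measurable_M) (simp_all add: sp)
  have null: "null_sets M \<subseteq> sets ?J"
    using \<eta>_fields(2)[of n] J(2) by (auto simp: subalgebra_def)
  show "sets (past_field M \<epsilon> n) \<subseteq> sets ?J"
    by (intro past_field_subset \<epsilon>_measurable J(1) null \<epsilon>_measurable_from_rank[OF p]
        measurable_from_subalg[OF J(2)] measurable_from_subalg[OF J(3)] measurable_past_field
        \<eta>_measurable measurable_var_field rank_var_measurable_M)
qed

text \<open>
  Up to time \<open>n\<close> the values of \<open>\<epsilon>\<close> come from the rank; from then on \<open>\<epsilon> (m + 1)\<close> is recovered from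
  its past and from \<open>\<eta> (m + 1)\<close>.
\<close>
lemma join_full_rank_var:
  assumes p: "AE \<omega> in M. atom_mass n \<omega> = p"
  shows "sets (join_field (full_field M \<eta>) (var_field M (rank_var n))) = sets (full_field M \<epsilon>)"
proof (rule antisym)
  let ?V = "var_field M (rank_var n)"
  let ?J = "join_field (full_field M \<eta>) ?V"
  note sp = \<epsilon>_fields(1,3) \<eta>_fields(1,3) space_var_field[OF rank_var_measurable_M]
  note from_past = measurable_from_subalg[OF subalgebra_full_past_field[of \<epsilon>, OF \<epsilon>_measurable]]
  have J: "space ?J = space M" "subalgebra ?J (full_field M \<eta>)" "subalgebra ?J ?V"
    using join_field[of "full_field M \<eta>" ?V] by (auto simp: subalgebra_def sp)
  show "sets ?J \<subseteq> sets (full_field M \<epsilon>)"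
    by (intro join_field full_field_subset var_field_subset \<epsilon>_fields from_past[OF rank_var_past_measurable]
        from_past[OF \<eta>_past_measurable[OF order_refl]] \<eta>_measurable rank_var_measurable_M) (simp_all add: sp)
  have null: "null_sets M \<subseteq> sets ?J"
    using \<eta>_fields(4) J(2) by (auto simp: subalgebra_def)
  have \<eta>J: "\<eta> k \<in> measurable ?J sign_space" for k
    by (intro measurable_from_subalg[OF J(2)] measurable_full_field \<eta>_measurable)
  have past: "\<epsilon> k \<in> measurable ?J sign_space" if "k \<le> n" for k
    by (intro \<epsilon>_measurable_from_rank[OF p J(1) null \<eta>J _ that] measurable_from_subalg[OF J(3)]
        measurable_var_field rank_var_measurable_M)
  have "\<forall>k\<le>m. \<epsilon> k \<in> measurable ?J sign_space" if "n \<le> m" for m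
    using that
  proof (induction rule: int_ge_induct)
    case base
    then show ?case using past by blast
  next
    case (step m)
    have "(\<lambda>\<omega>. H (m + 1) \<omega> * \<eta> (m + 1) \<omega>) \<in> measurable ?J sign_space"
      using step.IH by (intro times_sign_measurable H_measurable J(1) \<eta>J) auto
    moreover have "H (m + 1) \<omega> * \<eta> (m + 1) \<omega> = \<epsilon> (m + 1) \<omega>" if "\<omega> \<in> space ?J" for \<omega>
      using measurable_space[OF H_measurable_M, of \<omega> "m + 1"] that by (auto simp: \<eta>_def J(1))
    ultimately have "\<epsilon> (m + 1) \<in> measurable ?J sign_space" by (simp cong: measurable_cong)
    then show ?case using step.IH by (metis order_le_less zless_add1_eq)
  qed
  then have "\<epsilon> k \<in> measurable ?J sign_space" for k
    by (metis linear order_refl)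
  then show "sets (full_field M \<epsilon>) \<subseteq> sets ?J"
    by (intro full_field_subset \<epsilon>_measurable J(1) null)
qed

lemma rank_var_indep_full:
  assumes p: "AE \<omega> in M. atom_mass n \<omega> = p"
  shows "indep_set (sets (var_field M (rank_var n))) (sets (full_field M \<eta>))"
proof -
  let ?U = "{rank_var n -` S \<inter> space M | S. S \<in> sets borel}"
  let ?K = "\<Union>m. sets (history \<eta> m)"
  let ?E = "{\<eta> i -` B \<inter> space M | i B. i \<in> UNIV \<and> B \<in> sets sign_space}"
  have "indep_set ?U ?K"
  proof (rule indep_setI)
    show "?K \<subseteq> events" using subalgebra_history_\<eta> by (auto simp: subalgebra_def)
    fix a b assume "a \<in> ?U" "b \<in> ?K"
    then obtain S m where S: "a = rank_var n -` S \<inter> space M" "S \<in> sets borel" "b \<in> sets (history \<eta> m)" by blast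
    have "b \<in> sets (history \<eta> (max n m))" using S(3) history_mono[of m "max n m" \<eta>] by auto
    then show "prob (a \<inter> b) = prob a * prob b"
      unfolding S(1) using S(2) by (intro rank_var_indep_history[OF p, of "max n m"]) auto
  qed auto
  moreover have "Int_stable ?U" by (rule Int_stable_vimages)
  moreover have "Int_stable ?K"
    unfolding Int_stable_def
  proof safe
    fix a b i j assume "a \<in> sets (history \<eta> i)" "b \<in> sets (history \<eta> j)"
    then have "a \<in> sets (history \<eta> (max i j))" "b \<in> sets (history \<eta> (max i j))"
      using history_mono[of i "max i j" \<eta>] history_mono[of j "max i j" \<eta>] by auto
    then show "a \<inter> b \<in> ?K" by blast
  qed
  ultimately have "indep_set (sigma_sets (space M) ?U) (sigma_sets (space M) ?K)"
    by (rule indep_set_sigma_sets)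
  moreover have "sigma_sets (space M) ?E \<subseteq> sigma_sets (space M) ?K"
  proof (rule sigma_sets_mono', safe)
    fix i and B :: "int set" assume "B \<in> sets sign_space"
    then have "\<eta> i -` B \<inter> space M \<in> sets (history \<eta> i)"
      unfolding sets_history by (intro sigma_sets.Basic) (auto simp: events_of_def)
    then show "\<eta> i -` B \<inter> space M \<in> ?K" by blast
  qed
  ultimately have "indep_set (sigma_sets (space M) ?U) (sigma_sets (space M) ?E)"
    unfolding indep_sets2_eq by blast
  from indep_set_adjoin_null[OF this]
  have "indep_set (sigma_sets (space M) (?U \<union> null_sets M)) (sigma_sets (space M) (?E \<union> null_sets M))" .
  moreover have "sets (var_field M (rank_var n)) = sigma_sets (space M) (?U \<union> null_sets M)"
    unfolding var_field_def by (subst sets_completed_sigma) auto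
  moreover have "sets (full_field M \<eta>) = sigma_sets (space M) (?E \<union> null_sets M)"
    unfolding full_field_def by (subst sets_completed_sigma) auto
  ultimately show "indep_set (sets (var_field M (rank_var n))) (sets (full_field M \<eta>))" by simp
qed

text \<open>
  The same constant \<open>p\<close> serves all \<open>n\<close>, so the alternative and the number of points do not
  depend on \<open>n\<close>.
\<close>
lemma rank_var_uniform:
  assumes p: "\<And>n. AE \<omega> in M. atom_mass n \<omega> = p"
  shows "(\<exists>m. \<forall>n. \<exists>S. card S = m \<and> uniform_on_finite M (rank_var n) S) \<or>
     (\<forall>n. uniform_on_unit_interval M (rank_var n))"
proof (cases "p = 0")
  case True
  have "uniform_on_unit_interval M (rank_var n)" for n
  proof -
    interpret N: refining_words M "history \<eta> n" "past_bit n" by (rule refining_words_past_bit)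
    show ?thesis
      using N.rank_uniform_interval p[of n] True
      by (simp add: uniform_on_unit_interval_def rank_var_def atom_mass_def)
  qed
  then show ?thesis by blast
next
  case False
  have "\<exists>m>0. p = 1 / real m \<and> uniform_on_finite M (rank_var n) (grid m)" for n
  proof -
    interpret N: refining_words M "history \<eta> n" "past_bit n" by (rule refining_words_past_bit)
    obtain m where "0 < m" "p = 1 / real m"
      "distr M borel N.rank = distr (uniform_count_measure (grid m)) borel (\<lambda>x. x)"
      using N.rank_uniform_grid[OF p[of n, unfolded atom_mass_def] False] .
    then show ?thesis by (auto simp: uniform_on_finite_def rank_var_def grid_def)
  qed
  then obtain m where m: "\<And>n. 0 < m n" "\<And>n. p = 1 / real (m n)"
    "\<And>n. uniform_on_finite M (rank_var n) (grid (m n))" by metis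
  have "m n = m 0" for n using m(1)[of n] m(1)[of 0] m(2)[of n] m(2)[of 0] by simp
  then have "card (grid (m n)) = m 0" for n using card_grid[OF m(1), of n] by simp
  then show ?thesis using m(3) by blast
qed

end

theorem corollary4:
  fixes M :: "'a measure"
    and \<epsilon> H :: "int \<Rightarrow> 'a \<Rightarrow> int"
    and h :: "int \<Rightarrow> (int \<Rightarrow> int) \<Rightarrow> int"
  assumes "prob_space M"
    and "coin_tossing M \<epsilon>"
    and "\<And>n. h n \<in> measurable (PiM {..0} (\<lambda>_. sign_space)) sign_space"
    and "\<And>n \<omega>. \<omega> \<in> space M \<Longrightarrow> H n \<omega> = h n (past_at (\<lambda>k. \<epsilon> k \<omega>) (n - 1))"
  defines "H\<epsilon> \<equiv> \<lambda>n \<omega>. H n \<omega> * \<epsilon> n \<omega>"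
  shows "\<exists>U :: int \<Rightarrow> 'a \<Rightarrow> real.
    (\<forall>n. U n \<in> borel_measurable (past_field M \<epsilon> n) \<and>
         prob_space.indep_set M (sets (var_field M (U n))) (sets (full_field M H\<epsilon>)) \<and>
         sets (join_field (past_field M H\<epsilon> n) (var_field M (U n))) = sets (past_field M \<epsilon> n) \<and>
         sets (join_field (full_field M H\<epsilon>) (var_field M (U n))) = sets (full_field M \<epsilon>)) \<and>
    ((\<exists>m. \<forall>n. \<exists>S. card S = m \<and> uniform_on_finite M (U n) S) \<or>
     (\<forall>n. uniform_on_unit_interval M (U n)))"
proof -
  interpret coin_transform M \<epsilon> H h
    using assms(1-4) by (intro coin_transform.intro coin_transform_axioms.intro)
  have "H\<epsilon> = \<eta>" by (simp add: H\<epsilon>_def \<eta>_def fun_eq_iff)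
  obtain p where p: "\<And>n. AE \<omega> in M. atom_mass n \<omega> = p" by (rule atom_mass_constant) blast
  show ?thesis
    unfolding \<open>H\<epsilon> = \<eta>\<close>
    using rank_var_past_measurable rank_var_indep_full[OF p] join_past_rank_var[OF p]
      join_full_rank_var[OF p] rank_var_uniform[OF p]
    by (intro exI[of _ rank_var]) blast
qed

end
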